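(* Let $n\in\mathbb N$ and $\psi(x)=ax+b$ for $a,b\in\mathbb R$, $a\ne0$. Let $F\in\mathcal B_r$. Then $(F\circ\psi)^{(n)}=a^n\,(F^{(n)}\circ\psi)$ as distributions. Let $h\in\mathcal{IBV}^{n-1}$. Then $$\int_{-\infty}^\infty F^{(n)}h=|a|\int_{-\infty}^\infty(F^{(n)}\circ\psi)(h\circ\psi).$$
   Context: Write $\overline{\mathbb R}=[-\infty,\infty]$. A function $F:\overline{\mathbb R}\to\mathbb R$ is regulated if the one-sided limits $F(x-),F(x+)$ exist in $\mathbb R$ for every $x\in\mathbb R$ and the limits $\lim_{x\to\pm\infty}F(x)$ exist in $\mathbb R$; by convention $F(\pm\infty)$ equals these limits (also for functions of bounded variation). $\mathcal B_r$ is the space of regulated $F$ with $F(-\infty)=0$ and $F(x)=F(x-)$ for all $x\in\mathbb R$. $F^{(n)}$ is the $n$th distributional derivative. For a distribution $T$, the composition $T\circ\psi$ is defined by $\langle T\circ\psi,\phi\rangle=\bigl\langle T,\tfrac{1}{|a|}\,\phi\circ\psi^{-1}\bigr\rangle$ for $\phi\in C_c^\infty(\mathbb R)$. $\mathcal{BV}$ is the set of functions $g:\overline{\mathbb R}\to\mathbb R$ of bounded variation. For fixed $\lambda\in[0,1]$, $\mathcal{NBV}_\lambda$ is the set of $g\in\mathcal{BV}$ with $g(x)=(1-\lambda)g(x-)+\lambda g(x+)$ for all $x\in\mathbb R$. For locally integrable $q$, $I^0[q]=q$ and $I^m[q](x)=\int_0^xI^{m-1}[q](t)\,dt$; $\mathcal{IBV}^0=\mathcal{BV}$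 and $\mathcal{IBV}^m=\{I^m[g]:g\in\mathcal{BV}\}$ for $m\ge1$. Integral: fix $\lambda\in[0,1]$. For $h\in\mathcal{IBV}^{n-1}$ write $h=I^{n-1}[g]$, where $g=h$ if $n=1$ and $g$ is the unique such function in $\mathcal{NBV}_\lambda$ if $n\ge2$. Then $\int_{-\infty}^\infty F^{(n)}h=(-1)^{n-1}\int_{-\infty}^\infty g\,dF$, a Henstock--Stieltjes integral: $\int_{-\infty}^{\infty} g\,dF=A$ means that for each $\epsilon>0$ there is a gauge $\gamma$ (assigning to each $z\in\overline{\mathbb R}$ an open interval of $\overline{\mathbb R}$ containing $z$) such that $|\sum_ig(z_i)[F(x_i)-F(x_{i-1})]-A|<\epsilon$ for every partition $-\infty=x_0<\dots<x_N=\infty$ with tags $z_i\in[x_{i-1},x_i]\subset\gamma(z_i)$. For the right-hand integral in the claim: $F^{(n)}\circ\psi=(a^{-n}F\circ\psi)^{(n)}$ with $F\circ\psi$ regulated, and $h\circ\psi$ is an iterated integral whose $(n-1)$st derivative is taken to be $a^{n-1}\,g\circ\psi$; the integral means $(-1)^{n-1}\int_{-\infty}^\infty a^{n-1}(g\circ\psi)\,d(a^{-n}F\circ\psi)$ (additive constants in $F\circ\psi$ and polynomials of degree at most $n-2$ in $h\circ\psi$ do not matter). Here $\psi(\pm\infty)=\pm\infty$ if $a>0$ and $\mp\infty$ if $a<0$. *)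

theory Defs
  imports "HOL-Analysis.Analysis"
begin

section \<open>Regulated functions and functions of bounded variation on the extended real line\<close>

definition limits_at_infinity :: "(ereal \<Rightarrow> real) \<Rightarrow> bool" where
  "limits_at_infinity f \<longleftrightarrow>
     ((\<lambda>x. f (ereal x)) \<longlongrightarrow> f \<infinity>) at_top \<and> ((\<lambda>x. f (ereal x)) \<longlongrightarrow> f (-\<infinity>)) at_bot"

definition regulated :: "(ereal \<Rightarrow> real) \<Rightarrow> bool" where
  "regulated F \<longleftrightarrow>
     (\<forall>x::real. (\<exists>l. ((\<lambda>y. F (ereal y)) \<longlongrightarrow> l) (at_left x)) \<and>
                (\<exists>r. ((\<lambda>y. F (ereal y)) \<longlongrightarrow> r) (at_right x))) \<and>
     limits_at_infinity F"

definition B_r :: "(ereal \<Rightarrow> real) set" where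
  "B_r = {F. regulated F \<and> F (-\<infinity>) = 0 \<and>
             (\<forall>x::real. ((\<lambda>y. F (ereal y)) \<longlongrightarrow> F (ereal x)) (at_left x))}"

text \<open>The values at \<open>\<plusminus>\<infinity>\<close> of a function of bounded variation are, by convention, its limits there.\<close>

definition BV :: "(ereal \<Rightarrow> real) set" where
  "BV = {g. (\<exists>M. \<forall>N (x :: nat \<Rightarrow> ereal). (\<forall>i<N. x i < x (Suc i)) \<longrightarrow>
                   (\<Sum>i<N. \<bar>g (x (Suc i)) - g (x i)\<bar>) \<le> M) \<and>
            limits_at_infinity g}"

definition NBV :: "real \<Rightarrow> (ereal \<Rightarrow> real) set" where
  "NBV lam = {g \<in> BV. \<forall>x::real. \<exists>l r.
       ((\<lambda>y. g (ereal y)) \<longlongrightarrow> l) (at_left x) \<and>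
       ((\<lambda>y. g (ereal y)) \<longlongrightarrow> r) (at_right x) \<and>
       g (ereal x) = (1 - lam) * l + lam * r}"

section \<open>Iterated integrals\<close>

fun iter_integral :: "nat \<Rightarrow> (real \<Rightarrow> real) \<Rightarrow> real \<Rightarrow> real" where
  "iter_integral 0 q = q"
| "iter_integral (Suc m) q = (\<lambda>x. LBINT t=ereal 0..ereal x. iter_integral m q t)"

text \<open>Elements are functions on the real line. For \<open>m = 0\<close> the limit convention in \<^const>\<open>BV\<close>
  makes restriction to the real line injective, so nothing is lost.\<close>

definition IBV :: "nat \<Rightarrow> (real \<Rightarrow> real) set" where
  "IBV m = {iter_integral m (\<lambda>x. g (ereal x)) | g. g \<in> BV}"

text \<open>The function \<open>g\<close> with \<open>h = I\<^sup>m[g]\<close> that is used to integrate against \<open>h\<close>: for \<open>m = 0\<close> it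
  is \<open>h\<close> itself (with its limits at \<open>\<plusminus>\<infinity>\<close>), otherwise the normalised representative.\<close>

definition stieltjes_density :: "real \<Rightarrow> nat \<Rightarrow> (real \<Rightarrow> real) \<Rightarrow> ereal \<Rightarrow> real" where
  "stieltjes_density lam m h =
     (THE g. g \<in> (if m = 0 then BV else NBV lam) \<and> h = iter_integral m (\<lambda>x. g (ereal x)))"

section \<open>The Henstock--Stieltjes integral over the extended real line\<close>

definition ext_gauge :: "(ereal \<Rightarrow> ereal set) \<Rightarrow> bool" where
  "ext_gauge \<gamma> \<longleftrightarrow> (\<forall>z. z \<in> \<gamma> z \<and> open (\<gamma> z) \<and> (\<forall>u\<in>\<gamma> z. \<forall>v\<in>\<gamma> z. {u..v} \<subseteq> \<gamma> z))"

definition fine_partition ::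
    "(ereal \<Rightarrow> ereal set) \<Rightarrow> nat \<Rightarrow> (nat \<Rightarrow> ereal) \<Rightarrow> (nat \<Rightarrow> ereal) \<Rightarrow> bool" where
  "fine_partition \<gamma> N x z \<longleftrightarrow>
     x 0 = -\<infinity> \<and> x N = \<infinity> \<and>
     (\<forall>i<N. x i < x (Suc i) \<and> z i \<in> {x i..x (Suc i)} \<and> {x i..x (Suc i)} \<subseteq> \<gamma> (z i))"

definition has_HS_integral :: "(ereal \<Rightarrow> real) \<Rightarrow> (ereal \<Rightarrow> real) \<Rightarrow> real \<Rightarrow> bool" where
  "has_HS_integral g F A \<longleftrightarrow>
     (\<forall>\<epsilon>>0. \<exists>\<gamma>. ext_gauge \<gamma> \<and>
        (\<forall>N x z. fine_partition \<gamma> N x z \<longrightarrow>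
           \<bar>(\<Sum>i<N. g (z i) * (F (x (Suc i)) - F (x i))) - A\<bar> < \<epsilon>))"

definition HS_integrable :: "(ereal \<Rightarrow> real) \<Rightarrow> (ereal \<Rightarrow> real) \<Rightarrow> bool" where
  "HS_integrable g F \<longleftrightarrow> (\<exists>A. has_HS_integral g F A)"

definition HS_integral :: "(ereal \<Rightarrow> real) \<Rightarrow> (ereal \<Rightarrow> real) \<Rightarrow> real" where
  "HS_integral g F = (THE A. has_HS_integral g F A)"

section \<open>Distributions on the real line\<close>

text \<open>A distribution is represented by a functional of which only the values on test functions
  are meaningful; equality of distributions is \<open>dist_eq\<close>.\<close>

type_synonym distribution = "(real \<Rightarrow> real) \<Rightarrow> real"

definition test_function :: "(real \<Rightarrow> real) \<Rightarrow> bool" where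
  "test_function \<phi> \<longleftrightarrow>
     (\<forall>k x. (deriv ^^ k) \<phi> differentiable (at x)) \<and> compact (closure {x. \<phi> x \<noteq> 0})"

definition dist_eq :: "distribution \<Rightarrow> distribution \<Rightarrow> bool" where
  "dist_eq S T \<longleftrightarrow> (\<forall>\<phi>. test_function \<phi> \<longrightarrow> S \<phi> = T \<phi>)"

definition dist_of :: "(ereal \<Rightarrow> real) \<Rightarrow> distribution" where
  "dist_of F = (\<lambda>\<phi>. LBINT x. F (ereal x) * \<phi> x)"

definition dist_deriv :: "distribution \<Rightarrow> distribution" where
  "dist_deriv T = (\<lambda>\<phi>. - T (deriv \<phi>))"

definition dist_scale :: "real \<Rightarrow> distribution \<Rightarrow> distribution" where
  "dist_scale c T = (\<lambda>\<phi>. c * T \<phi>)"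

definition affine_map :: "real \<Rightarrow> real \<Rightarrow> real \<Rightarrow> real" where
  "affine_map a b x = a * x + b"

definition dist_compose_affine :: "real \<Rightarrow> real \<Rightarrow> distribution \<Rightarrow> distribution" where
  "dist_compose_affine a b T = (\<lambda>\<phi>. T (\<lambda>y. 1 / \<bar>a\<bar> * (\<phi> \<circ> inv (affine_map a b)) y))"

text \<open>For \<open>a \<noteq> 0\<close>, extended-real arithmetic gives the intended values at \<open>\<plusminus>\<infinity>\<close>:
  these points are fixed if \<open>a > 0\<close> and swapped if \<open>a < 0\<close>.\<close>

definition ext_affine :: "real \<Rightarrow> real \<Rightarrow> ereal \<Rightarrow> ereal" where
  "ext_affine a b x = ereal a * x + ereal b"

section \<open>Integrals of products of distributions and iterated integrals\<close>

text \<open>The integral of \<open>\<Phi>\<^sup>(\<^sup>n\<^sup>)\<close> times a function whose \<open>(n - 1)\<close>st derivative is taken to be \<open>G\<close>.\<close>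

definition primitive_integral :: "nat \<Rightarrow> (ereal \<Rightarrow> real) \<Rightarrow> (ereal \<Rightarrow> real) \<Rightarrow> real" where
  "primitive_integral n \<Phi> G = (-1) ^ (n - 1) * HS_integral G \<Phi>"

text \<open>The integral of \<open>F\<^sup>(\<^sup>n\<^sup>) h\<close>.\<close>

definition dist_integrable :: "real \<Rightarrow> nat \<Rightarrow> (ereal \<Rightarrow> real) \<Rightarrow> (real \<Rightarrow> real) \<Rightarrow> bool" where
  "dist_integrable lam n F h \<longleftrightarrow> HS_integrable (stieltjes_density lam (n - 1) h) F"

definition dist_integral :: "real \<Rightarrow> nat \<Rightarrow> (ereal \<Rightarrow> real) \<Rightarrow> (real \<Rightarrow> real) \<Rightarrow> real" where
  "dist_integral lam n F h = primitive_integral n F (stieltjes_density lam (n - 1) h)"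

text \<open>The integral of \<open>(F\<^sup>(\<^sup>n\<^sup>) \<circ> \<psi>) (h \<circ> \<psi>)\<close> for \<open>\<psi> x = a x + b\<close>. Here \<open>F\<^sup>(\<^sup>n\<^sup>) \<circ> \<psi>\<close> is the \<open>n\<close>th
  derivative of \<open>a\<^sup>-\<^sup>n (F \<circ> \<psi>)\<close>, which is regulated but in general not in \<^const>\<open>B_r\<close>, and the
  \<open>(n - 1)\<close>st derivative of \<open>h \<circ> \<psi>\<close> is taken to be \<open>a\<^sup>n\<^sup>-\<^sup>1 (g \<circ> \<psi>)\<close> with \<open>g\<close> the density of \<open>h\<close>.
  In general this is not the normalised representative: \<open>a < 0\<close> exchanges one-sided limits.\<close>

definition primitive_compose ::
    "real \<Rightarrow> real \<Rightarrow> nat \<Rightarrow> (ereal \<Rightarrow> real) \<Rightarrow> ereal \<Rightarrow> real" where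
  "primitive_compose a b n F = (\<lambda>x. F (ext_affine a b x) / a ^ n)"

definition density_compose ::
    "real \<Rightarrow> real \<Rightarrow> real \<Rightarrow> nat \<Rightarrow> (real \<Rightarrow> real) \<Rightarrow> ereal \<Rightarrow> real" where
  "density_compose a b lam m h = (\<lambda>x. a ^ m * stieltjes_density lam m h (ext_affine a b x))"

definition dist_integrable_compose ::
    "real \<Rightarrow> real \<Rightarrow> real \<Rightarrow> nat \<Rightarrow> (ereal \<Rightarrow> real) \<Rightarrow> (real \<Rightarrow> real) \<Rightarrow> bool" where
  "dist_integrable_compose a b lam n F h \<longleftrightarrow>
     HS_integrable (density_compose a b lam (n - 1) h) (primitive_compose a b n F)"

definition dist_integral_compose ::
    "real \<Rightarrow> real \<Rightarrow> real \<Rightarrow> nat \<Rightarrow> (ereal \<Rightarrow> real) \<Rightarrow> (real \<Rightarrow> real) \<Rightarrow> real" where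
  "dist_integral_compose a b lam n F h =
     primitive_integral n (primitive_compose a b n F) (density_compose a b lam (n - 1) h)"

end

theory Submission
  imports Defs
begin

text \<open>The distributional identity is a linear change of variables, each derivative of a test
  function composed with \<open>\<psi>\<^sup>-\<^sup>1\<close> contributing a factor \<open>1 / a\<close>. For the integrals, the substitution
  \<open>\<psi>\<close> carries gauges and tagged partitions of the extended line to one another, reversing their
  orientation if \<open>a < 0\<close>; hence \<open>\<integral> (g \<circ> \<psi>) d(F \<circ> \<psi>) = sgn a \<integral> g dF\<close>, and the factors
  \<open>a\<^sup>n\<^sup>-\<^sup>1\<close> and \<open>a\<^sup>-\<^sup>n\<close> turn this into \<open>1 / \<bar>a\<bar>\<close>. The integral exists because \<open>F\<close> is a uniform limit of
  step functions, which are integrators for every integrand, while summation by parts bounds the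
  Riemann sums of a monotone \<open>g\<close> by a constant times the supremum norm of the integrator.\<close>

section \<open>Distributions and affine changes of variable\<close>

text \<open>\<open>stieltjes_density\<close> and \<open>HS_integral\<close> are definite
  descriptions, so either integral is accessible only once existence and uniqueness are settled on
  two levels. For the integral, uniqueness needs every gauge to admit a fine partition, since
  otherwise its condition is vacuous. For a normalised density, existence comes from averaging the
  one-sided limits of an arbitrary \<open>g\<close>, which alters it only on a countable set, and
  uniqueness from the fact that the first antiderivative determines all one-sided limits. Since
  \<open>g\<close> and \<open>F\<close> may jump at the same point, refining the mesh alone does not
  make Riemann sums converge; the gauge is what forces a tag onto each jump. For
  \<open>a < 0\<close> the composition of a density in \<open>NBV lam\<close> with \<psi> belongs to
  the weight \<open>1 - lam\<close>, because left and right limits are exchanged. The Riemann sums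
  are therefore transported with the original \<open>g\<close>, instead of looking for a new density
  of the composed function.\<close>

lemma dist_deriv_funpow: "(dist_deriv ^^ n) T \<phi> = (-1) ^ n * T ((deriv ^^ n) \<phi>)"
proof (induction n arbitrary: \<phi>)
  case (Suc n)
  then show ?case
    by (simp add: dist_deriv_def funpow_swap1)
qed simp

lemma inv_affine_map:
  assumes "a \<noteq> 0"
  shows "inv (affine_map a b) y = (y - b) / a"
proof (rule inv_f_eq)
  show "inj (affine_map a b)"
    using assms by (auto intro!: injI simp: affine_map_def)
qed (use assms in \<open>simp add: affine_map_def\<close>)

text \<open>\<open>deriv\<close> is total, so the chain rule at each order rests on the
  differentiability in \<open>diff\<close>. The factor \<open>c\<close> takes in the
  \<open>1 / \<bar>a\<bar>\<close> of \<open>dist_compose_affine\<close>.\<close>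

lemma deriv_funpow_compose_affine:
  fixes \<phi> :: "real \<Rightarrow> real"
  assumes diff: "\<And>k x. (deriv ^^ k) \<phi> differentiable (at x)" and a: "a \<noteq> 0"
  shows "(deriv ^^ n) (\<lambda>y. c * \<phi> ((y - b) / a)) = (\<lambda>y. c / a ^ n * (deriv ^^ n) \<phi> ((y - b) / a))"
proof (induction n)
  case (Suc n)
  have "deriv (\<lambda>y. c / a ^ n * (deriv ^^ n) \<phi> ((y - b) / a)) y =
      c / a ^ Suc n * (deriv ^^ Suc n) \<phi> ((y - b) / a)" for y
  proof (rule DERIV_imp_deriv)
    have "((deriv ^^ n) \<phi> has_real_derivative (deriv ^^ Suc n) \<phi> ((y - b) / a)) (at ((y - b) / a))"
      using diff[of n "(y - b) / a"] by (simp add: DERIV_deriv_iff_real_differentiable)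
    moreover have "((\<lambda>y. (y - b) / a) has_real_derivative 1 / a) (at y)"
      using a by (auto intro!: derivative_eq_intros)
    ultimately have "((\<lambda>y. (deriv ^^ n) \<phi> ((y - b) / a)) has_real_derivative
        (deriv ^^ Suc n) \<phi> ((y - b) / a) * (1 / a)) (at y)"
      by (rule DERIV_chain2[where f = "(deriv ^^ n) \<phi>" and g = "\<lambda>y. (y - b) / a" and x = y])
    from DERIV_cmult[OF this, of "c / a ^ n"]
    show "((\<lambda>y. c / a ^ n * (deriv ^^ n) \<phi> ((y - b) / a)) has_real_derivative
        c / a ^ Suc n * (deriv ^^ Suc n) \<phi> ((y - b) / a)) (at y)"
      by (simp add: field_simps)
  qed
  then show ?case
    using Suc by auto
qed simp

text \<open>After the substitution y = a x + b both sides are one Lebesgue integral: the Jacobian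
  cancels the \<open>1 / \<bar>a\<bar>\<close> of the composition, and the n chain-rule factors
  cancel \<open>a ^ n\<close>. The substitution formula also covers non-integrable functions, whose
  integral is 0 by default, so \<open>F\<close> can be arbitrary.\<close>

lemma dist_deriv_compose_affine:
  assumes a: "a \<noteq> 0"
  shows "dist_eq ((dist_deriv ^^ n) (dist_of (F \<circ> ext_affine a b)))
           (dist_scale (a ^ n) (dist_compose_affine a b ((dist_deriv ^^ n) (dist_of F))))"
  unfolding dist_eq_def
proof (intro allI impI)
  fix \<phi> assume "test_function \<phi>"
  then have diff: "\<And>k x. (deriv ^^ k) \<phi> differentiable (at x)"
    by (simp add: test_function_def)
  have 1: "(deriv ^^ n) (\<lambda>y. 1 / \<bar>a\<bar> * (\<phi> \<circ> inv (affine_map a b)) y) =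
      (\<lambda>y. (1 / \<bar>a\<bar>) / a ^ n * (deriv ^^ n) \<phi> ((y - b) / a))"
    using deriv_funpow_compose_affine[OF diff a, where c = "1 / \<bar>a\<bar>" and b = b and n = n]
    by (simp add: inv_affine_map[OF a])
  have "(LBINT x. F (ereal x) * ((1 / \<bar>a\<bar>) / a ^ n * (deriv ^^ n) \<phi> ((x - b) / a)))
      = \<bar>a\<bar> * (LBINT x. F (ereal (b + a * x)) * ((1 / \<bar>a\<bar>) / a ^ n * (deriv ^^ n) \<phi> x))"
    using lborel_integral_real_affine[OF a, of
        "\<lambda>x. F (ereal x) * ((1 / \<bar>a\<bar>) / a ^ n * (deriv ^^ n) \<phi> ((x - b) / a))" b] a
    by simp
  also have "(\<lambda>x. F (ereal (b + a * x)) * ((1 / \<bar>a\<bar>) / a ^ n * (deriv ^^ n) \<phi> x)) =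
      (\<lambda>x. (1 / \<bar>a\<bar>) / a ^ n * (F (ereal (a * x + b)) * (deriv ^^ n) \<phi> x))"
    by (simp add: fun_eq_iff add.commute)
  finally have 2: "a ^ n * (LBINT x. F (ereal x) * ((1 / \<bar>a\<bar>) / a ^ n * (deriv ^^ n) \<phi> ((x - b) / a)))
      = (LBINT x. F (ereal (a * x + b)) * (deriv ^^ n) \<phi> x)"
    using a by simp
  have 3: "(F \<circ> ext_affine a b) (ereal x) = F (ereal (a * x + b))" for x
    by (simp add: ext_affine_def)
  show "(dist_deriv ^^ n) (dist_of (F \<circ> ext_affine a b)) \<phi> =
      dist_scale (a ^ n) (dist_compose_affine a b ((dist_deriv ^^ n) (dist_of F))) \<phi>"
    unfolding dist_scale_def dist_compose_affine_def dist_deriv_funpow 1 dist_of_def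
      3 2[symmetric]
    by (rule mult.left_commute)
qed

section \<open>Cousin's lemma and uniqueness of the Henstock--Stieltjes integral\<close>

text \<open>Real induction: \<open>left\<close> puts the supremum of the points satisfying
  \<open>P\<close> into that set, and \<open>right\<close> would push beyond it unless it is
  \<infinity>. \<open>P\<close> may fail between points where it holds. Both Cousin's lemma and the
  step function approximation are instances.\<close>

lemma ereal_continuous_induct:
  fixes P :: "ereal \<Rightarrow> bool"
  assumes bot: "P (-\<infinity>)"
    and left: "\<And>z. z \<noteq> -\<infinity> \<Longrightarrow> \<forall>\<^sub>F u in at_left z. P u \<longrightarrow> P z"
    and right: "\<And>z. z \<noteq> \<infinity> \<Longrightarrow> \<forall>\<^sub>F v in at_right z. P z \<longrightarrow> P v"
  shows "P \<infinity>"
proof -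
  define s where "s = Sup {u. P u}"
  have upper: "u \<le> s" if "P u" for u
    unfolding s_def using that by (auto intro: Sup_upper)
  have "P s"
  proof (cases "s = -\<infinity>")
    case False
    then have "- \<infinity> < s" by simp
    from left[OF False] obtain y where y: "y < s" "\<And>u. y < u \<Longrightarrow> u < s \<Longrightarrow> P u \<longrightarrow> P s"
      unfolding eventually_at_left[OF \<open>-\<infinity> < s\<close>] by blast
    from y(1) obtain u where "P u" "y < u"
      unfolding s_def less_Sup_iff by auto
    with y(2)[of u] upper[of u] show ?thesis
      by (cases "u = s") auto
  qed (use bot in simp)
  have "s = \<infinity>"
  proof (rule ccontr)
    assume "s \<noteq> \<infinity>"
    then have "s < \<infinity>" by simp
    from right[OF \<open>s \<noteq> \<infinity>\<close>] obtain y where y: "y > s" "\<And>u. s < u \<Longrightarrow> u < y \<Longrightarrow> P s \<longrightarrow> P u"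
      unfolding eventually_at_right[OF \<open>s < \<infinity>\<close>] by blast
    obtain u where u: "s < u" "u < y"
      using dense[OF y(1)] by auto
    then have "P u" using y(2)[of u] \<open>P s\<close> by blast
    then show False using upper[of u] u by simp
  qed
  with \<open>P s\<close> show ?thesis by simp
qed

text \<open>Cousin's lemma, by continuous induction on the right end \<open>c\<close> of an initial
  segment that has a fine partition.\<close>

lemma fine_partition_exists:
  assumes "ext_gauge \<gamma>"
  shows "\<exists>N x z. fine_partition \<gamma> N x z"
proof -
  have g: "z \<in> \<gamma> z" "open (\<gamma> z)" "u \<in> \<gamma> z \<Longrightarrow> v \<in> \<gamma> z \<Longrightarrow> {u..v} \<subseteq> \<gamma> z" for u v z
    using assms unfolding ext_gauge_def by blast+
  define P where "P c \<longleftrightarrow> (\<exists>N x z. x 0 = -\<infinity> \<and> x N = c \<and>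
     (\<forall>i<N. x i < x (Suc i) \<and> z i \<in> {x i..x (Suc i)} \<and> {x i..x (Suc i)} \<subseteq> \<gamma> (z i)))" for c
  \<comment> \<open>Appends one interval. The induction uses it with the tag at \<open>v\<close>
    when approaching from the left and at \<open>u\<close> when leaving to the right;
    order-convexity of the gauge set gives \<open>{u..v}\<close> from its two end points.\<close>
  have step: "P v" if "P u" "u < v" "z \<in> {u..v}" "u \<in> \<gamma> z" "v \<in> \<gamma> z" for u v z
  proof -
    from \<open>P u\<close> obtain N x w where *: "x 0 = -\<infinity>" "x N = u"
      "\<And>i. i < N \<Longrightarrow> x i < x (Suc i) \<and> w i \<in> {x i..x (Suc i)} \<and> {x i..x (Suc i)} \<subseteq> \<gamma> (w i)"
      unfolding P_def by blast
    show ?thesis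
      unfolding P_def
    proof (intro exI conjI allI impI)
      show "(x(Suc N := v)) 0 = -\<infinity>" "(x(Suc N := v)) (Suc N) = v"
        using * by auto
    next
      fix i assume "i < Suc N"
      then consider "i < N" | "i = N" by linarith
      then show "(x(Suc N := v)) i < (x(Suc N := v)) (Suc i)"
        "(w(N := z)) i \<in> {(x(Suc N := v)) i..(x(Suc N := v)) (Suc i)}"
        "{(x(Suc N := v)) i..(x(Suc N := v)) (Suc i)} \<subseteq> \<gamma> ((w(N := z)) i)"
        using * that g(3)[of u z v] by (cases; force)+
    qed
  qed
  have "P \<infinity>"
  proof (rule ereal_continuous_induct)
    show "P (-\<infinity>)"
      unfolding P_def by (rule exI[of _ 0]) auto
  next
    fix z :: ereal
    have ev: "\<forall>\<^sub>F u in nhds z. u \<in> \<gamma> z"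
      using g[of z] eventually_nhds_in_open by blast
    show "\<forall>\<^sub>F u in at_left z. P u \<longrightarrow> P z"
      unfolding eventually_at_filter using ev
      by eventually_elim (auto intro: step[where z = z] g(1))
    show "\<forall>\<^sub>F v in at_right z. P z \<longrightarrow> P v"
      unfolding eventually_at_filter using ev
      by eventually_elim (auto intro: step[where z = z] g(1))
  qed
  then show ?thesis
    unfolding P_def fine_partition_def by blast
qed

section \<open>Common gauges, uniqueness and linearity of the integral\<close>

lemma ext_gauge_Int:
  assumes "ext_gauge \<gamma>" "ext_gauge \<delta>"
  shows "ext_gauge (\<lambda>z. \<gamma> z \<inter> \<delta> z)"
  using assms unfolding ext_gauge_def by (simp add: open_Int)

lemma fine_partition_Int:
  "fine_partition (\<lambda>z. \<gamma> z \<inter> \<delta> z) N x z \<longleftrightarrow> fine_partition \<gamma> N x z \<and> fine_partition \<delta> N x z"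
  unfolding fine_partition_def by blast

lemma has_HS_integralE:
  assumes "has_HS_integral g F A" "\<epsilon> > 0"
  obtains \<gamma> where "ext_gauge \<gamma>"
    "\<And>N x z. fine_partition \<gamma> N x z \<Longrightarrow>
       \<bar>(\<Sum>i<N. g (z i) * (F (x (Suc i)) - F (x i))) - A\<bar> < \<epsilon>"
  using assms unfolding has_HS_integral_def by blast

lemma has_HS_integral_common_gauge:
  assumes "has_HS_integral g F A" "has_HS_integral h G B" "\<epsilon> > 0"
  obtains \<gamma> where "ext_gauge \<gamma>"
    "\<And>N x z. fine_partition \<gamma> N x z \<Longrightarrow>
       \<bar>(\<Sum>i<N. g (z i) * (F (x (Suc i)) - F (x i))) - A\<bar> < \<epsilon>"
    "\<And>N x z. fine_partition \<gamma> N x z \<Longrightarrow>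
       \<bar>(\<Sum>i<N. h (z i) * (G (x (Suc i)) - G (x i))) - B\<bar> < \<epsilon>"
proof -
  obtain \<gamma> where \<gamma>: "ext_gauge \<gamma>"
    "\<And>N x z. fine_partition \<gamma> N x z \<Longrightarrow>
       \<bar>(\<Sum>i<N. g (z i) * (F (x (Suc i)) - F (x i))) - A\<bar> < \<epsilon>"
    using has_HS_integralE[OF assms(1,3)] by blast
  obtain \<delta> where \<delta>: "ext_gauge \<delta>"
    "\<And>N x z. fine_partition \<delta> N x z \<Longrightarrow>
       \<bar>(\<Sum>i<N. h (z i) * (G (x (Suc i)) - G (x i))) - B\<bar> < \<epsilon>"
    using has_HS_integralE[OF assms(2,3)] by blast
  show ?thesis
    by (rule that[OF ext_gauge_Int[OF \<gamma>(1) \<delta>(1)]])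
      (simp_all only: fine_partition_Int \<gamma>(2) \<delta>(2))
qed

text \<open>A partition fine for both gauges exists by Cousin's lemma, and its single Riemann sum
  would have to be within half the distance of both values.\<close>

lemma has_HS_integral_unique:
  assumes "has_HS_integral g F A" "has_HS_integral g F B"
  shows "A = B"
proof (rule ccontr)
  assume "A \<noteq> B"
  then have "\<bar>A - B\<bar> / 2 > 0" by simp
  from has_HS_integral_common_gauge[OF assms this] obtain \<gamma> where \<gamma>: "ext_gauge \<gamma>"
    "\<And>N x z. fine_partition \<gamma> N x z \<Longrightarrow>
       \<bar>(\<Sum>i<N. g (z i) * (F (x (Suc i)) - F (x i))) - A\<bar> < \<bar>A - B\<bar> / 2"
    "\<And>N x z. fine_partition \<gamma> N x z \<Longrightarrow>
       \<bar>(\<Sum>i<N. g (z i) * (F (x (Suc i)) - F (x i))) - B\<bar> < \<bar>A - B\<bar> / 2"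
    by blast
  obtain N x z where fp: "fine_partition \<gamma> N x z"
    using fine_partition_exists[OF \<gamma>(1)] by blast
  define S where "S = (\<Sum>i<N. g (z i) * (F (x (Suc i)) - F (x i)))"
  have "\<bar>A - B\<bar> \<le> \<bar>S - A\<bar> + \<bar>S - B\<bar>" by linarith
  also have "\<dots> < \<bar>A - B\<bar> / 2 + \<bar>A - B\<bar> / 2"
    unfolding S_def by (rule add_strict_mono[OF \<gamma>(2)[OF fp] \<gamma>(3)[OF fp]])
  finally show False by simp
qed

lemma HS_integral_eq:
  assumes "has_HS_integral g F A"
  shows "HS_integral g F = A"
  unfolding HS_integral_def
  by (rule the_equality[where P = "has_HS_integral g F", OF assms])
    (rule has_HS_integral_unique[OF _ assms])

lemma has_HS_integral_scale:
  assumes "has_HS_integral g F A"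
  shows "has_HS_integral (\<lambda>x. c * g x) (\<lambda>x. d * F x) (c * d * A)"
  unfolding has_HS_integral_def
proof (intro allI impI)
  fix \<epsilon> :: real assume "\<epsilon> > 0"
  \<comment> \<open>The summand 1 keeps the quotient meaningful when \<open>c * d\<close> is
    0.\<close>
  then have "\<epsilon> / (\<bar>c * d\<bar> + 1) > 0" by (simp add: add_nonneg_pos)
  from has_HS_integralE[OF assms this] obtain \<gamma> where \<gamma>: "ext_gauge \<gamma>"
    "\<And>N x z. fine_partition \<gamma> N x z \<Longrightarrow>
       \<bar>(\<Sum>i<N. g (z i) * (F (x (Suc i)) - F (x i))) - A\<bar> < \<epsilon> / (\<bar>c * d\<bar> + 1)"
    by blast
  show "\<exists>\<gamma>. ext_gauge \<gamma> \<and> (\<forall>N x z. fine_partition \<gamma> N x z \<longrightarrow>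
      \<bar>(\<Sum>i<N. c * g (z i) * (d * F (x (Suc i)) - d * F (x i))) - c * d * A\<bar> < \<epsilon>)"
  proof (intro exI conjI allI impI)
    fix N x z assume fp: "fine_partition \<gamma> N x z"
    have "(\<Sum>i<N. c * g (z i) * (d * F (x (Suc i)) - d * F (x i))) - c * d * A =
        (c * d) * ((\<Sum>i<N. g (z i) * (F (x (Suc i)) - F (x i))) - A)"
      by (simp add: algebra_simps sum_distrib_left sum_subtractf)
    also have "\<bar>\<dots>\<bar> \<le> \<bar>c * d\<bar> * (\<epsilon> / (\<bar>c * d\<bar> + 1))"
      by (subst abs_mult) (rule mult_left_mono[OF less_imp_le[OF \<gamma>(2)[OF fp]] abs_ge_zero])
    also have "\<dots> < \<epsilon>"
      using \<open>\<epsilon> > 0\<close> by (simp add: divide_simps add_nonneg_pos)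
    finally show "\<bar>(\<Sum>i<N. c * g (z i) * (d * F (x (Suc i)) - d * F (x i))) - c * d * A\<bar> < \<epsilon>" .
  qed (rule \<gamma>(1))
qed

text \<open>Assuming the identity for single Riemann terms covers additivity both in the integrator,
  used to add jumps, and in the integrand, used to subtract monotone parts.\<close>

lemma has_HS_integral_combine:
  assumes f: "has_HS_integral g F A" and h: "has_HS_integral h G B"
    and eq: "\<And>x y z. k z * (H y - H x) = g z * (F y - F x) + h z * (G y - G x)"
  shows "has_HS_integral k H (A + B)"
  unfolding has_HS_integral_def
proof (intro allI impI)
  fix \<epsilon> :: real assume "\<epsilon> > 0"
  then have "\<epsilon> / 2 > 0" by simp
  from has_HS_integral_common_gauge[OF f h this] obtain \<gamma> where \<gamma>: "ext_gauge \<gamma>"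
    "\<And>N x z. fine_partition \<gamma> N x z \<Longrightarrow>
       \<bar>(\<Sum>i<N. g (z i) * (F (x (Suc i)) - F (x i))) - A\<bar> < \<epsilon> / 2"
    "\<And>N x z. fine_partition \<gamma> N x z \<Longrightarrow>
       \<bar>(\<Sum>i<N. h (z i) * (G (x (Suc i)) - G (x i))) - B\<bar> < \<epsilon> / 2"
    by blast
  show "\<exists>\<gamma>. ext_gauge \<gamma> \<and> (\<forall>N x z. fine_partition \<gamma> N x z \<longrightarrow>
      \<bar>(\<Sum>i<N. k (z i) * (H (x (Suc i)) - H (x i))) - (A + B)\<bar> < \<epsilon>)"
  proof (intro exI conjI allI impI)
    fix N x z assume fp: "fine_partition \<gamma> N x z"
    show "\<bar>(\<Sum>i<N. k (z i) * (H (x (Suc i)) - H (x i))) - (A + B)\<bar> < \<epsilon>"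
      unfolding eq sum.distrib using abs_diff_triangle_ineq add_strict_mono[OF \<gamma>(2)[OF fp] \<gamma>(3)[OF fp]]
      by (rule order.strict_trans1[OF _ ord_less_eq_trans]) simp
  qed (rule \<gamma>(1))
qed

section \<open>Functions of bounded variation against regulated functions\<close>

text \<open>Only tags at \<open>c\<close> contribute once the gauge makes every other tag avoid \<open>c\<close>.\<close>

lemma has_HS_integral_single_jump:
  assumes lo: "\<And>t. t < c \<Longrightarrow> F t = p" and hi: "\<And>t. t > c \<Longrightarrow> F t = q"
  shows "has_HS_integral g F (g c * (F \<infinity> - F (-\<infinity>)))"
  unfolding has_HS_integral_def
proof (intro allI impI)
  fix \<epsilon> :: real assume "\<epsilon> > 0"
  define \<gamma> where "\<gamma> z = (if z < c then {..<c} else if z > c then {c<..} else UNIV)" for z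
  show "\<exists>\<gamma>. ext_gauge \<gamma> \<and> (\<forall>N x z. fine_partition \<gamma> N x z \<longrightarrow>
      \<bar>(\<Sum>i<N. g (z i) * (F (x (Suc i)) - F (x i))) - g c * (F \<infinity> - F (-\<infinity>))\<bar> < \<epsilon>)"
  proof (intro exI conjI allI impI)
    show "ext_gauge \<gamma>"
      unfolding ext_gauge_def
    proof (intro allI conjI ballI)
      fix w show "w \<in> \<gamma> w" "open (\<gamma> w)" by (simp_all add: \<gamma>_def)
    next
      fix w u v assume "u \<in> \<gamma> w" "v \<in> \<gamma> w"
      then show "{u..v} \<subseteq> \<gamma> w"
        by (cases "w < c"; cases "w > c") (auto simp: \<gamma>_def)
    qed
    fix N x z assume fp: "fine_partition \<gamma> N x z"
    have eq: "g (z i) * (F (x (Suc i)) - F (x i)) = g c * (F (x (Suc i)) - F (x i))" if "i < N" for i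
    proof (cases "z i = c")
      case False
      have "x i < x (Suc i)" "{x i..x (Suc i)} \<subseteq> \<gamma> (z i)"
        using fp that unfolding fine_partition_def by blast+
      then have "x i \<in> \<gamma> (z i)" "x (Suc i) \<in> \<gamma> (z i)"
        by auto
      with False have "F (x (Suc i)) = F (x i)"
        by (auto simp: \<gamma>_def lo hi split: if_splits)
      then show ?thesis by simp
    qed simp
    have "(\<Sum>i<N. g (z i) * (F (x (Suc i)) - F (x i))) =
        g c * (\<Sum>i<N. F (x (Suc i)) - F (x i))"
      unfolding sum_distrib_left by (rule sum.cong[OF refl], rule eq) simp
    \<comment> \<open>The value \<open>F c\<close> cancels in the telescoping sum. The Riemann sum
      equals the integral exactly, so one gauge serves every \<epsilon>.\<close>
    also have "\<dots> = g c * (F \<infinity> - F (-\<infinity>))"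
      using fp sum_lessThan_telescope[of "\<lambda>i. F (x i)" N] by (simp add: fine_partition_def)
    finally show "\<bar>(\<Sum>i<N. g (z i) * (F (x (Suc i)) - F (x i))) - g c * (F \<infinity> - F (-\<infinity>))\<bar> < \<epsilon>"
      using \<open>\<epsilon> > 0\<close> by simp
  qed
qed

text \<open>Restated with the filters of the extended line, so that the induction can treat the
  infinite end points like finite ones.\<close>

lemma regulated_lim_left:
  assumes "regulated F" "z \<noteq> -\<infinity>"
  shows "\<exists>l. (F \<longlongrightarrow> l) (at_left z)"
proof (cases z)
  case (real r)
  from assms(1) obtain l where "((\<lambda>y. F (ereal y)) \<longlongrightarrow> l) (at_left r)"
    unfolding regulated_def by blast
  then show ?thesis
    unfolding real at_left_ereal[of r] by (auto simp: filterlim_filtermap)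
next
  case PInf
  have "((\<lambda>y. F (ereal y)) \<longlongrightarrow> F \<infinity>) at_top"
    using assms(1) unfolding regulated_def limits_at_infinity_def by blast
  then show ?thesis
    unfolding PInf at_left_PInf by (auto simp: filterlim_filtermap)
qed (use assms in auto)

lemma regulated_lim_right:
  assumes "regulated F" "z \<noteq> \<infinity>"
  shows "\<exists>l. (F \<longlongrightarrow> l) (at_right z)"
proof (cases z)
  case (real r)
  from assms(1) obtain l where "((\<lambda>y. F (ereal y)) \<longlongrightarrow> l) (at_right r)"
    unfolding regulated_def by blast
  then show ?thesis
    unfolding real at_right_ereal[of r] by (auto simp: filterlim_filtermap)
next
  case MInf
  have "((\<lambda>y. F (ereal y)) \<longlongrightarrow> F (-\<infinity>)) at_bot"
    using assms(1) unfolding regulated_def limits_at_infinity_def by blast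
  then show ?thesis
    unfolding MInf at_right_MInf by (auto simp: filterlim_filtermap)
qed (use assms in auto)

text \<open>The approximant is kept constant to the right of \<open>c\<close>, so that it extends past \<open>c\<close> by
  adding single jumps.\<close>

lemma regulated_approximation:
  assumes F: "regulated F" and "\<epsilon> > 0"
  shows "\<exists>S. (\<forall>g. HS_integrable g S) \<and> (\<forall>t. \<bar>F t - S t\<bar> \<le> \<epsilon>)"
proof -
  define P where "P c \<longleftrightarrow> (\<exists>S. (\<forall>g. HS_integrable g S) \<and>
      (\<forall>t\<le>c. \<bar>F t - S t\<bar> \<le> \<epsilon>) \<and> (\<forall>t\<ge>c. S t = F c))" for c
  have step: "P v" if "P u" "u < v" "\<And>t. u < t \<Longrightarrow> t < v \<Longrightarrow> \<bar>F t - l\<bar> \<le> \<epsilon>" for u v l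
  proof -
    from \<open>P u\<close> obtain S where S: "\<And>g. HS_integrable g S"
      "\<And>t. t \<le> u \<Longrightarrow> \<bar>F t - S t\<bar> \<le> \<epsilon>" "\<And>t. u \<le> t \<Longrightarrow> S t = F u"
      unfolding P_def by blast
    \<comment> \<open>\<open>J\<close> moves the constant continuation from \<open>F u\<close> to
      \<open>l\<close> strictly after \<open>u\<close>, and \<open>K\<close> moves it from
      \<open>l\<close> to \<open>F v\<close> at \<open>v\<close> itself. The sum is thus
      \<open>l\<close> inside the interval and exact at \<open>v\<close>, and its values up to
      \<open>u\<close> are unchanged.\<close>
    define J where "J t = (if u < t then l - F u else 0)" for t
    define K where "K t = (if v \<le> t then F v - l else 0)" for t
    have "HS_integrable g (\<lambda>t. S t + J t + K t)" for g
    proof -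
      obtain A where A: "has_HS_integral g S A"
        using S(1) unfolding HS_integrable_def by blast
      have J: "has_HS_integral g J (g u * (J \<infinity> - J (-\<infinity>)))"
        by (rule has_HS_integral_single_jump[where p = 0 and q = "l - F u"]) (auto simp: J_def)
      have K: "has_HS_integral g K (g v * (K \<infinity> - K (-\<infinity>)))"
        by (rule has_HS_integral_single_jump[where p = 0 and q = "F v - l"]) (auto simp: K_def)
      have "has_HS_integral g (\<lambda>t. S t + J t) (A + g u * (J \<infinity> - J (-\<infinity>)))"
        by (rule has_HS_integral_combine[OF A J]) (simp add: algebra_simps)
      from has_HS_integral_combine[OF this K, of g "\<lambda>t. S t + J t + K t"] show ?thesis
        unfolding HS_integrable_def by (auto simp: algebra_simps)
    qed
    moreover have "\<bar>F t - (S t + J t + K t)\<bar> \<le> \<epsilon>" if tv: "t \<le> v" for t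
    proof -
      consider "t \<le> u" | "u < t" "t < v" | "t = v" using tv by fastforce
      then show ?thesis
        using S \<open>u < v\<close> \<open>\<And>t. u < t \<Longrightarrow> t < v \<Longrightarrow> \<bar>F t - l\<bar> \<le> \<epsilon>\<close> \<open>\<epsilon> > 0\<close>
        by cases (auto simp: J_def K_def)
    qed
    moreover have "S t + J t + K t = F v" if "v \<le> t" for t
      using that \<open>u < v\<close> S(3)[of t] by (auto simp: J_def K_def)
    ultimately show ?thesis
      unfolding P_def by (intro exI[of _ "\<lambda>t. S t + J t + K t"]) auto
  qed
  have "P \<infinity>"
  proof (rule ereal_continuous_induct)
    have "HS_integrable g (\<lambda>t. F (-\<infinity>))" for g
      unfolding HS_integrable_def by (rule exI, rule has_HS_integral_single_jump) auto
    then show "P (-\<infinity>)"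
      unfolding P_def using \<open>\<epsilon> > 0\<close> by (intro exI[of _ "\<lambda>t. F (-\<infinity>)"]) auto
  next
    fix z :: ereal assume z: "z \<noteq> -\<infinity>"
    then have z': "-\<infinity> < z" by simp
    obtain l where "(F \<longlongrightarrow> l) (at_left z)"
      using regulated_lim_left[OF F z] by blast
    then have "\<forall>\<^sub>F t in at_left z. \<bar>F t - l\<bar> < \<epsilon>"
      using \<open>\<epsilon> > 0\<close> by (auto dest!: tendstoD simp: dist_real_def)
    then obtain y where y: "y < z" "\<And>t. y < t \<Longrightarrow> t < z \<Longrightarrow> \<bar>F t - l\<bar> < \<epsilon>"
      by (auto simp: eventually_at_left[OF z'])
    show "\<forall>\<^sub>F u in at_left z. P u \<longrightarrow> P z"
      unfolding eventually_at_left[OF z']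
    proof (intro exI[of _ y] conjI allI impI y(1))
      fix u assume u: "y < u" "u < z" "P u"
      show "P z"
        by (rule step[OF u(3,2), of l]) (use u y(2) in \<open>force intro: less_imp_le\<close>)
    qed
  next
    fix z :: ereal assume z: "z \<noteq> \<infinity>"
    then have z': "z < \<infinity>" by simp
    obtain l where "(F \<longlongrightarrow> l) (at_right z)"
      using regulated_lim_right[OF F z] by blast
    then have "\<forall>\<^sub>F t in at_right z. \<bar>F t - l\<bar> < \<epsilon>"
      using \<open>\<epsilon> > 0\<close> by (auto dest!: tendstoD simp: dist_real_def)
    then obtain y where y: "y > z" "\<And>t. z < t \<Longrightarrow> t < y \<Longrightarrow> \<bar>F t - l\<bar> < \<epsilon>"
      by (auto simp: eventually_at_right[OF z'])
    show "\<forall>\<^sub>F v in at_right z. P z \<longrightarrow> P v"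
      unfolding eventually_at_right[OF z']
    proof (intro exI[of _ y] conjI allI impI y(1))
      fix v assume v: "z < v" "v < y" "P z"
      show "P v"
        by (rule step[OF v(3,1), of l]) (use v y(2) in \<open>force intro: less_imp_le\<close>)
    qed
  qed
  then show ?thesis
    unfolding P_def by (metis ereal_less_eq(1))
qed

section \<open>Monotone integrands against regulated integrators\<close>

lemma mono_ereal_bounded:
  fixes g :: "ereal \<Rightarrow> real"
  assumes "mono g"
  shows "\<bar>g t\<bar> \<le> \<bar>g \<infinity>\<bar> + \<bar>g (-\<infinity>)\<bar>"
  using monoD[OF assms, of t \<infinity>] monoD[OF assms, of "-\<infinity>" t] by simp

lemma sum_by_parts_Suc:
  fixes G D :: "nat \<Rightarrow> real"
  shows "(\<Sum>i<Suc K. G i * (D (Suc i) - D i)) =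
      G K * D (Suc K) - G 0 * D 0 - (\<Sum>i<K. (G (Suc i) - G i) * D (Suc i))"
  by (induction K) (simp_all add: algebra_simps)

text \<open>Summation by parts moves the differences from \<open>D\<close> to \<open>g\<close>.
  Consecutive tags are separated by a partition point, so the increments of \<open>g\<close> are
  nonnegative and telescope to at most 2M, where M bounds \<bar>g\<bar>; the two boundary terms
  contribute M each, hence the 4. Fineness is irrelevant, so the bound can be used with any
  gauge.\<close>

lemma riemann_sum_mono_bound:
  fixes g D :: "ereal \<Rightarrow> real"
  assumes g: "mono g" and D: "\<And>t. \<bar>D t\<bar> \<le> \<epsilon>" and fp: "fine_partition \<gamma> N x z"
  shows "\<bar>\<Sum>i<N. g (z i) * (D (x (Suc i)) - D (x i))\<bar> \<le> 4 * (\<bar>g \<infinity>\<bar> + \<bar>g (-\<infinity>)\<bar>) * \<epsilon>"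
proof -
  define M where "M = \<bar>g \<infinity>\<bar> + \<bar>g (-\<infinity>)\<bar>"
  have M: "\<bar>g t\<bar> \<le> M" for t
    unfolding M_def by (rule mono_ereal_bounded[OF g])
  have "0 \<le> \<epsilon>" using D[of 0] by linarith
  \<comment> \<open>A partition without intervals would identify -\<infinity> and
    \<infinity>.\<close>
  obtain K where K: "N = Suc K"
    using fp unfolding fine_partition_def by (cases N) auto
  have zz: "g (z i) \<le> g (z (Suc i))" if "i < K" for i
  proof -
    have "z i \<le> x (Suc i)" "x (Suc i) \<le> z (Suc i)"
      using fp that K unfolding fine_partition_def by auto
    then show ?thesis
      using monoD[OF g] order_trans by blast
  qed
  have "\<bar>\<Sum>i<K. (g (z (Suc i)) - g (z i)) * D (x (Suc i))\<bar> \<le>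
      (\<Sum>i<K. \<bar>(g (z (Suc i)) - g (z i)) * D (x (Suc i))\<bar>)"
    by (rule sum_abs)
  also have "\<dots> \<le> (\<Sum>i<K. (g (z (Suc i)) - g (z i)) * \<epsilon>)"
    by (rule sum_mono) (use zz D in \<open>auto simp: abs_mult intro!: mult_mono\<close>)
  also have "\<dots> = (g (z K) - g (z 0)) * \<epsilon>"
    by (simp add: sum_distrib_right[symmetric] sum_lessThan_telescope[of "\<lambda>i. g (z i)"])
  also have "\<dots> \<le> (2 * M) * \<epsilon>"
    using M[of "z K"] M[of "z 0"] \<open>0 \<le> \<epsilon>\<close> by (intro mult_right_mono) auto
  finally have 1: "\<bar>\<Sum>i<K. (g (z (Suc i)) - g (z i)) * D (x (Suc i))\<bar> \<le> 2 * M * \<epsilon>" .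
  have 2: "\<bar>g (z K) * D (x (Suc K))\<bar> \<le> M * \<epsilon>" "\<bar>g (z 0) * D (x 0)\<bar> \<le> M * \<epsilon>"
    using M D by (auto simp: abs_mult M_def intro!: mult_mono)
  show ?thesis
    unfolding K sum_by_parts_Suc[of "\<lambda>i. g (z i)" "\<lambda>i. D (x i)"] M_def[symmetric]
    using 1 2 by linarith
qed

text \<open>On every partition the Riemann sums of \<open>F\<close> and of its kth approximant
  differ by at most \<open>inverse (Suc k)\<close>. Hence the integrals of the approximants form a
  Cauchy sequence, and its limit is the integral against \<open>F\<close>.\<close>

lemma HS_integrable_mono_regulated:
  assumes g: "mono g" and F: "regulated F"
  shows "HS_integrable g F"
proof -
  \<comment> \<open>The constant of \<open>riemann_sum_mono_bound\<close>, raised by 1 so that it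
    can be divided by.\<close>
  define C where "C = 4 * (\<bar>g \<infinity>\<bar> + \<bar>g (-\<infinity>)\<bar>) + 1"
  have C: "C > 0" by (simp add: C_def add_nonneg_pos)
  have ex: "\<exists>S A. has_HS_integral g S A \<and> (\<forall>t. \<bar>F t - S t\<bar> \<le> inverse (Suc k) / C)" for k
    using regulated_approximation[OF F, of "inverse (Suc k) / C"] C
    unfolding HS_integrable_def by force
  then obtain S A where SA: "\<And>k. has_HS_integral g (S k) (A k)"
    "\<And>k t. \<bar>F t - S k t\<bar> \<le> inverse (Suc k) / C"
    by metis
  have close: "\<bar>(\<Sum>i<N. g (z i) * (F (x (Suc i)) - F (x i))) -
      (\<Sum>i<N. g (z i) * (S k (x (Suc i)) - S k (x i)))\<bar> \<le> inverse (Suc k)"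
    if "fine_partition \<gamma> N x z" for \<gamma> N x z k
  proof -
    have "(\<Sum>i<N. g (z i) * (F (x (Suc i)) - F (x i))) -
      (\<Sum>i<N. g (z i) * (S k (x (Suc i)) - S k (x i))) =
      (\<Sum>i<N. g (z i) * ((F (x (Suc i)) - S k (x (Suc i))) - (F (x i) - S k (x i))))"
      by (simp add: sum_subtractf[symmetric] algebra_simps)
    also have "\<bar>\<dots>\<bar> \<le> 4 * (\<bar>g \<infinity>\<bar> + \<bar>g (-\<infinity>)\<bar>) * (inverse (Suc k) / C)"
      by (rule riemann_sum_mono_bound[OF g SA(2) that])
    also have "\<dots> \<le> C * (inverse (Suc k) / C)"
      using C by (intro mult_right_mono) (auto simp: C_def)
    also have "\<dots> = inverse (Suc k)" using C by simp
    finally show ?thesis .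
  qed
  \<comment> \<open>The integrals are compared through one partition fine for both approximants; the
    remaining error \<open>e\<close> is arbitrary.\<close>
  have AA: "\<bar>A k - A l\<bar> \<le> inverse (Suc k) + inverse (Suc l)" for k l
  proof (rule field_le_epsilon)
    fix e :: real assume "e > 0"
    then have "e / 2 > 0" by simp
    from has_HS_integral_common_gauge[OF SA(1)[of k] SA(1)[of l] this] obtain \<gamma> where \<gamma>: "ext_gauge \<gamma>"
    "\<And>N x z. fine_partition \<gamma> N x z \<Longrightarrow>
       \<bar>(\<Sum>i<N. g (z i) * (S k (x (Suc i)) - S k (x i))) - A k\<bar> < e / 2"
    "\<And>N x z. fine_partition \<gamma> N x z \<Longrightarrow>
       \<bar>(\<Sum>i<N. g (z i) * (S l (x (Suc i)) - S l (x i))) - A l\<bar> < e / 2"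
      by blast
    obtain N x z where fp: "fine_partition \<gamma> N x z"
      using fine_partition_exists[OF \<gamma>(1)] by blast
    from \<gamma>(2,3)[OF fp] close[OF fp, of k] close[OF fp, of l]
    show "\<bar>A k - A l\<bar> \<le> inverse (Suc k) + inverse (Suc l) + e" by linarith
  qed
  have "Cauchy A"
  proof (rule metric_CauchyI)
    fix e :: real assume "e > 0"
    then obtain n where n: "inverse (real (Suc n)) < e / 2"
      using reals_Archimedean[of "e / 2"] by auto
    show "\<exists>M. \<forall>m\<ge>M. \<forall>n\<ge>M. dist (A m) (A n) < e"
    proof (intro exI[of _ n] allI impI)
      fix k l assume kl: "n \<le> k" "n \<le> l"
      then have "inverse (real (Suc k)) \<le> inverse (real (Suc n))"
        "inverse (real (Suc l)) \<le> inverse (real (Suc n))"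
        by (auto intro!: le_imp_inverse_le)
      with n AA[of k l] show "dist (A k) (A l) < e"
        unfolding dist_real_def by linarith
    qed
  qed
  then obtain B where B: "A \<longlonglongrightarrow> B"
    using Cauchy_convergent convergent_def by blast
  have "has_HS_integral g F B"
    unfolding has_HS_integral_def
  proof (intro allI impI)
    fix e :: real assume "e > 0"
    have "\<forall>\<^sub>F k in sequentially. \<bar>A k - B\<bar> < e / 3"
      using tendstoD[OF B, of "e / 3"] \<open>e > 0\<close> by (simp add: dist_real_def)
    moreover have "\<forall>\<^sub>F k in sequentially. inverse (real (Suc k)) < e / 3"
      using order_tendstoD(2)[OF LIMSEQ_inverse_real_of_nat, of "e / 3"] \<open>e > 0\<close> by simp
    ultimately have "\<forall>\<^sub>F k in sequentially. \<bar>A k - B\<bar> < e / 3 \<and> inverse (real (Suc k)) < e / 3"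
      by (rule eventually_conj)
    then obtain k where k: "\<bar>A k - B\<bar> < e / 3" "inverse (real (Suc k)) < e / 3"
      using eventually_happens' trivial_limit_sequentially by blast
    have "e / 3 > 0" using \<open>e > 0\<close> by simp
    from has_HS_integralE[OF SA(1)[of k] this] obtain \<gamma> where \<gamma>: "ext_gauge \<gamma>"
      "\<And>N x z. fine_partition \<gamma> N x z \<Longrightarrow>
       \<bar>(\<Sum>i<N. g (z i) * (S k (x (Suc i)) - S k (x i))) - A k\<bar> < e / 3"
      by blast
    show "\<exists>\<gamma>. ext_gauge \<gamma> \<and> (\<forall>N x z. fine_partition \<gamma> N x z \<longrightarrow>
      \<bar>(\<Sum>i<N. g (z i) * (F (x (Suc i)) - F (x i))) - B\<bar> < e)"
    proof (intro exI conjI allI impI)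
      fix N x z assume fp: "fine_partition \<gamma> N x z"
      show "\<bar>(\<Sum>i<N. g (z i) * (F (x (Suc i)) - F (x i))) - B\<bar> < e"
        using \<gamma>(2)[OF fp] close[OF fp, of k] k by linarith
    qed (rule \<gamma>(1))
  qed
  then show ?thesis
    unfolding HS_integrable_def by blast
qed

section \<open>Jordan decomposition and bounded variation\<close>

lemma variation_bounded_imp_mono_diff:
  fixes g :: "ereal \<Rightarrow> real"
  assumes M: "\<And>N (x :: nat \<Rightarrow> ereal). (\<And>i. i < N \<Longrightarrow> x i < x (Suc i)) \<Longrightarrow>
                   (\<Sum>i<N. \<bar>g (x (Suc i)) - g (x i)\<bar>) \<le> M"
  obtains P Q where "mono P" "mono Q" "\<And>t. g t = P t - Q t"
proof -
  \<comment> \<open>Variation sums over chains that start anywhere and end at \<open>c\<close>; the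
    chain with \<open>N = 0\<close> makes the set nonempty. \<open>V c\<close> is the variation of
    \<open>g\<close> up to \<open>c\<close>, and the decomposition is \<open>V\<close> minus
    \<open>V - g\<close>.\<close>
  define X where "X c = {\<Sum>i<N. \<bar>g (x (Suc i)) - g (x i)\<bar> | N (x :: nat \<Rightarrow> ereal).
      (\<forall>i<N. x i < x (Suc i)) \<and> x N = c}" for c
  define V where "V c = Sup (X c)" for c
  have bdd: "bdd_above (X c)" for c
    unfolding X_def by (rule bdd_aboveI[of _ M]) (use M in blast)
  have ne: "X c \<noteq> {}" for c
    unfolding X_def by (auto intro!: exI[of _ 0])
  \<comment> \<open>Appending \<open>d\<close> to a chain ending at \<open>c\<close> adds exactly
    this term. Monotonicity of \<open>V\<close> and of \<open>V - g\<close> follows by bounding the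
    absolute value below by 0 and by \<open>g d - g c\<close>.\<close>
  have key: "V c + \<bar>g d - g c\<bar> \<le> V d" if "c < d" for c d
  proof -
    have "V c \<le> V d - \<bar>g d - g c\<bar>"
      unfolding V_def[of c]
    proof (rule cSup_least[OF ne])
      fix s assume "s \<in> X c"
      then obtain N x where x: "s = (\<Sum>i<N. \<bar>g (x (Suc i)) - g (x i)\<bar>)"
        "\<forall>i<N. x i < x (Suc i)" "x N = c"
        unfolding X_def by blast
      define y where "y = x(Suc N := d)"
      have y: "y i = x i" if "i \<le> N" for i using that by (simp add: y_def)
      have "(\<Sum>i<N. \<bar>g (y (Suc i)) - g (y i)\<bar>) = s"
        unfolding x(1) by (rule sum.cong) (auto simp: y)
      then have "(\<Sum>i<Suc N. \<bar>g (y (Suc i)) - g (y i)\<bar>) = s + \<bar>g d - g c\<bar>"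
        using x(3) by (simp add: y_def)
      moreover have "\<forall>i<Suc N. y i < y (Suc i)" "y (Suc N) = d"
        using x that by (auto simp: y_def less_Suc_eq)
      ultimately have "s + \<bar>g d - g c\<bar> \<in> X d"
        unfolding X_def mem_Collect_eq by (intro exI[of _ "Suc N"] exI[of _ y]) simp
      then have "s + \<bar>g d - g c\<bar> \<le> V d"
        unfolding V_def by (rule cSup_upper[OF _ bdd])
      then show "s \<le> V d - \<bar>g d - g c\<bar>" by simp
    qed
    then show ?thesis by simp
  qed
  show ?thesis
  proof (rule that)
    show "mono V"
    proof (rule monoI)
      fix c d :: ereal assume "c \<le> d"
      then show "V c \<le> V d"
        using order_le_imp_less_or_eq key[of c d] abs_ge_zero[of "g d - g c"] by (cases "c = d") fastforce+
    qed
    show "mono (\<lambda>t. V t - g t)"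
    proof (rule monoI)
      fix c d :: ereal assume "c \<le> d"
      then show "V c - g c \<le> V d - g d"
        using order_le_imp_less_or_eq key[of c d] abs_ge_self[of "g d - g c"] by (cases "c = d") fastforce+
    qed
  qed simp
qed

lemma mono_diff_variation_bounded:
  fixes P Q :: "ereal \<Rightarrow> real"
  assumes P: "mono P" and Q: "mono Q" and x: "\<forall>i<N. x i < x (Suc i)"
  shows "(\<Sum>i<N. \<bar>(P (x (Suc i)) - Q (x (Suc i))) - (P (x i) - Q (x i))\<bar>)
    \<le> (P \<infinity> - P (-\<infinity>)) + (Q \<infinity> - Q (-\<infinity>))"
proof -
  have "(\<Sum>i<N. \<bar>(P (x (Suc i)) - Q (x (Suc i))) - (P (x i) - Q (x i))\<bar>)
     \<le> (\<Sum>i<N. (P (x (Suc i)) - P (x i)) + (Q (x (Suc i)) - Q (x i)))"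
  proof (rule sum_mono)
    fix i assume "i \<in> {..<N}"
    then have "x i \<le> x (Suc i)" using x by (simp add: less_imp_le)
    then show "\<bar>(P (x (Suc i)) - Q (x (Suc i))) - (P (x i) - Q (x i))\<bar>
       \<le> (P (x (Suc i)) - P (x i)) + (Q (x (Suc i)) - Q (x i))"
      using monoD[OF P] monoD[OF Q] by (simp add: abs_le_iff)
  qed
  also have "\<dots> = (P (x N) - P (x 0)) + (Q (x N) - Q (x 0))"
    by (simp add: sum.distrib sum_lessThan_telescope[of "\<lambda>i. P (x i)"]
        sum_lessThan_telescope[of "\<lambda>i. Q (x i)"])
  also have "\<dots> \<le> (P \<infinity> - P (-\<infinity>)) + (Q \<infinity> - Q (-\<infinity>))"
    using monoD[OF P, of "x N" \<infinity>] monoD[OF P, of "-\<infinity>" "x 0"]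
      monoD[OF Q, of "x N" \<infinity>] monoD[OF Q, of "-\<infinity>" "x 0"] by simp
  finally show ?thesis .
qed

text \<open>Reduces one-sided limits, measurability, boundedness and integrability to monotone
  functions. The limit condition stays separate because the monotone parts may jump at the infinite
  points.\<close>

lemma BV_iff_mono_diff:
  "g \<in> BV \<longleftrightarrow> limits_at_infinity g \<and> (\<exists>P Q. mono P \<and> mono Q \<and> g = (\<lambda>t. P t - Q t))"
proof
  assume "g \<in> BV"
  then obtain M where M: "\<And>N (x :: nat \<Rightarrow> ereal). (\<And>i. i < N \<Longrightarrow> x i < x (Suc i)) \<Longrightarrow>
                   (\<Sum>i<N. \<bar>g (x (Suc i)) - g (x i)\<bar>) \<le> M" and "limits_at_infinity g"
    unfolding BV_def by blast
  obtain P Q where "mono P" "mono Q" "\<And>t. g t = P t - Q t"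
    using variation_bounded_imp_mono_diff[where g = g and M = M, OF M] by blast
  with \<open>limits_at_infinity g\<close>
  show "limits_at_infinity g \<and> (\<exists>P Q. mono P \<and> mono Q \<and> g = (\<lambda>t. P t - Q t))"
    by (intro conjI exI[of _ P] exI[of _ Q]) auto
next
  assume "limits_at_infinity g \<and> (\<exists>P Q. mono P \<and> mono Q \<and> g = (\<lambda>t. P t - Q t))"
  then obtain P Q where lim: "limits_at_infinity g" and P: "mono P" and Q: "mono Q"
    and g: "g = (\<lambda>t. P t - Q t)" by blast
  show "g \<in> BV"
    unfolding BV_def mem_Collect_eq
  proof (intro conjI lim exI allI impI)
    fix N and x :: "nat \<Rightarrow> ereal" assume "\<forall>i<N. x i < x (Suc i)"
    from mono_diff_variation_bounded[OF P Q this]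
    show "(\<Sum>i<N. \<bar>g (x (Suc i)) - g (x i)\<bar>) \<le> (P \<infinity> - P (-\<infinity>)) + (Q \<infinity> - Q (-\<infinity>))"
      unfolding g .
  qed
qed

lemma HS_integrable_BV_regulated:
  assumes "g \<in> BV" and F: "regulated F"
  shows "HS_integrable g F"
proof -
  from assms(1) obtain P Q where P: "mono P" and Q: "mono Q" and g: "g = (\<lambda>t. P t - Q t)"
    unfolding BV_iff_mono_diff by blast
  obtain A B where A: "has_HS_integral P F A" and "has_HS_integral Q F B"
    using HS_integrable_mono_regulated[OF P F] HS_integrable_mono_regulated[OF Q F]
    unfolding HS_integrable_def by blast
  then have B: "has_HS_integral (\<lambda>x. -1 * Q x) (\<lambda>x. 1 * F x) (-1 * 1 * B)"
    by (intro has_HS_integral_scale)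
  show ?thesis
    unfolding HS_integrable_def
    by (rule exI, rule has_HS_integral_combine[OF A B]) (simp add: g algebra_simps)
qed

section \<open>Affine substitution in the Henstock--Stieltjes integral\<close>

text \<open>Continuity preserves openness of the gauge sets, and monotonicity in either direction
  preserves their order-convexity.\<close>

lemma ext_gauge_vimage:
  assumes "ext_gauge \<gamma>" and cont: "continuous_on UNIV \<psi>" and "mono \<psi> \<or> antimono \<psi>"
  shows "ext_gauge (\<lambda>z. \<psi> -` \<gamma> (\<psi> z))"
proof -
  have "open (\<psi> -` \<gamma> (\<psi> z))" for z
    using assms(1) cont by (intro open_vimage) (auto simp: ext_gauge_def)
  moreover have "{u..v} \<subseteq> \<psi> -` \<gamma> (\<psi> z)" if "u \<in> \<psi> -` \<gamma> (\<psi> z)" "v \<in> \<psi> -` \<gamma> (\<psi> z)" for u v z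
  proof
    fix t assume "t \<in> {u..v}"
    then have "\<psi> t \<in> {\<psi> u..\<psi> v} \<or> \<psi> t \<in> {\<psi> v..\<psi> u}"
      using assms(3) by (auto dest: monoD antimonoD)
    then show "t \<in> \<psi> -` \<gamma> (\<psi> z)"
      using assms(1) that unfolding ext_gauge_def by blast
  qed
  ultimately show ?thesis
    using assms(1) unfolding ext_gauge_def by auto
qed

text \<open>The image of a partition fine for the pulled-back gauge is fine for the original one:
  the images of the end points lie in the gauge set, and order-convexity fills in what lies between.
  The two Riemann sums then coincide term by term.\<close>

lemma has_HS_integral_compose_increasing:
  assumes int: "has_HS_integral g F A" and mono: "strict_mono \<psi>"
    and cont: "continuous_on UNIV \<psi>" and ends: "\<psi> (-\<infinity>) = -\<infinity>" "\<psi> \<infinity> = \<infinity>"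
  shows "has_HS_integral (\<lambda>t. g (\<psi> t)) (\<lambda>t. F (\<psi> t)) A"
  unfolding has_HS_integral_def
proof (intro allI impI)
  fix \<epsilon> :: real assume "\<epsilon> > 0"
  from has_HS_integralE[OF int this] obtain \<gamma> where \<gamma>: "ext_gauge \<gamma>"
    "\<And>N x z. fine_partition \<gamma> N x z \<Longrightarrow>
       \<bar>(\<Sum>i<N. g (z i) * (F (x (Suc i)) - F (x i))) - A\<bar> < \<epsilon>"
    by blast
  show "\<exists>\<gamma>. ext_gauge \<gamma> \<and> (\<forall>N x z. fine_partition \<gamma> N x z \<longrightarrow>
      \<bar>(\<Sum>i<N. g (\<psi> (z i)) * (F (\<psi> (x (Suc i))) - F (\<psi> (x i)))) - A\<bar> < \<epsilon>)"
  proof (intro exI conjI allI impI)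
    show "ext_gauge (\<lambda>z. \<psi> -` \<gamma> (\<psi> z))"
      using ext_gauge_vimage[OF \<gamma>(1) cont] strict_mono_mono[OF mono] by blast
    fix N x z assume fp: "fine_partition (\<lambda>z. \<psi> -` \<gamma> (\<psi> z)) N x z"
    have "fine_partition \<gamma> N (\<lambda>i. \<psi> (x i)) (\<lambda>i. \<psi> (z i))"
      unfolding fine_partition_def
    proof (intro conjI allI impI)
      fix i assume "i < N"
      then have *: "x i < x (Suc i)" "z i \<in> {x i..x (Suc i)}"
        "{x i..x (Suc i)} \<subseteq> \<psi> -` \<gamma> (\<psi> (z i))"
        using fp unfolding fine_partition_def by blast+
      have "x i \<in> \<psi> -` \<gamma> (\<psi> (z i))" "x (Suc i) \<in> \<psi> -` \<gamma> (\<psi> (z i))"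
        by (rule subsetD[OF *(3)], simp add: less_imp_le[OF *(1)])+
      then show "{\<psi> (x i)..\<psi> (x (Suc i))} \<subseteq> \<gamma> (\<psi> (z i))"
        using \<gamma>(1) unfolding ext_gauge_def by blast
      show "\<psi> (x i) < \<psi> (x (Suc i))"
        using * mono by (simp add: strict_mono_less)
      show "\<psi> (z i) \<in> {\<psi> (x i)..\<psi> (x (Suc i))}"
        using * mono by (simp add: strict_mono_less_eq)
    qed (use fp ends in \<open>auto simp: fine_partition_def\<close>)
    from \<gamma>(2)[OF this]
    show "\<bar>(\<Sum>i<N. g (\<psi> (z i)) * (F (\<psi> (x (Suc i))) - F (\<psi> (x i)))) - A\<bar> < \<epsilon>" .
  qed
qed

text \<open>Negation reverses the order of the partition, so each increment of the integrator
  changes sign while its tag is kept.\<close>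

lemma has_HS_integral_reflect:
  assumes int: "has_HS_integral g F A"
  shows "has_HS_integral (\<lambda>t. g (- t)) (\<lambda>t. F (- t)) (- A)"
  unfolding has_HS_integral_def
proof (intro allI impI)
  fix \<epsilon> :: real assume "\<epsilon> > 0"
  from has_HS_integralE[OF int this] obtain \<gamma> where \<gamma>: "ext_gauge \<gamma>"
    "\<And>N x z. fine_partition \<gamma> N x z \<Longrightarrow>
       \<bar>(\<Sum>i<N. g (z i) * (F (x (Suc i)) - F (x i))) - A\<bar> < \<epsilon>"
    by blast
  show "\<exists>\<gamma>. ext_gauge \<gamma> \<and> (\<forall>N x z. fine_partition \<gamma> N x z \<longrightarrow>
      \<bar>(\<Sum>i<N. g (- z i) * (F (- x (Suc i)) - F (- x i))) - - A\<bar> < \<epsilon>)"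
  proof (intro exI conjI allI impI)
    have "continuous_on UNIV (uminus :: ereal \<Rightarrow> ereal)"
      by (rule continuous_uminus_ereal)
    moreover have "antimono (uminus :: ereal \<Rightarrow> ereal)"
      by (rule antimonoI) simp
    ultimately show "ext_gauge (\<lambda>z. uminus -` \<gamma> (- z))"
      using ext_gauge_vimage[OF \<gamma>(1)] by blast
    fix N x z assume fp: "fine_partition (\<lambda>z. uminus -` \<gamma> (- z)) N x z"
    \<comment> \<open>The \<open>N + 1\<close> points are reversed by \<open>N - i\<close>, the
      \<open>N\<close> tags by \<open>N - Suc i\<close>: interval \<open>i\<close> of the new
      partition is the reflection of interval \<open>N - Suc i\<close> of the old one.\<close>
    have "fine_partition \<gamma> N (\<lambda>i. - x (N - i)) (\<lambda>i. - z (N - Suc i))"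
      unfolding fine_partition_def
    proof (intro conjI allI impI)
      fix i assume i: "i < N"
      define j where "j = N - Suc i"
      have j: "j < N" "N - i = Suc j" "N - Suc i = j" using i by (auto simp: j_def)
      have *: "x j < x (Suc j)" "z j \<in> {x j..x (Suc j)}"
        "{x j..x (Suc j)} \<subseteq> uminus -` \<gamma> (- z j)"
        using fp j unfolding fine_partition_def by blast+
      have "x j \<in> uminus -` \<gamma> (- z j)" "x (Suc j) \<in> uminus -` \<gamma> (- z j)"
        by (rule subsetD[OF *(3)], simp add: less_imp_le[OF *(1)])+
      then show "{- x (N - i)..- x (N - Suc i)} \<subseteq> \<gamma> (- z (N - Suc i))"
        using \<gamma>(1) unfolding ext_gauge_def j by blast
      show "- x (N - i) < - x (N - Suc i)" "- z (N - Suc i) \<in> {- x (N - i)..- x (N - Suc i)}"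
        using * unfolding j by auto
    qed (use fp in \<open>auto simp: fine_partition_def\<close>)
    from \<gamma>(2)[OF this]
    have 1: "\<bar>(\<Sum>i<N. g (- z (N - Suc i)) * (F (- x (N - Suc i)) - F (- x (N - i)))) - A\<bar> < \<epsilon>" .
    have "(\<Sum>i<N. g (- z i) * (F (- x (Suc i)) - F (- x i))) =
        (\<Sum>i<N. g (- z (N - Suc i)) * (F (- x (Suc (N - Suc i))) - F (- x (N - Suc i))))"
      by (rule sum.nat_diff_reindex[symmetric])
    also have "\<dots> = - (\<Sum>i<N. g (- z (N - Suc i)) * (F (- x (N - Suc i)) - F (- x (N - i))))"
      unfolding sum_negf[symmetric]
      by (rule sum.cong) (auto simp: Suc_diff_Suc algebra_simps)
    finally show "\<bar>(\<Sum>i<N. g (- z i) * (F (- x (Suc i)) - F (- x i))) - - A\<bar> < \<epsilon>"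
      using 1 by linarith
  qed
qed

lemma has_HS_integral_compose_affine_pos:
  assumes int: "has_HS_integral g F A" and a: "a > 0"
  shows "has_HS_integral (\<lambda>t. g (ext_affine a b t)) (\<lambda>t. F (ext_affine a b t)) A"
proof (rule has_HS_integral_compose_increasing[OF int])
  show "strict_mono (ext_affine a b)"
  proof (rule strict_monoI)
    fix x y :: ereal assume "x < y"
    then show "ext_affine a b x < ext_affine a b y"
      using a by (cases x; cases y) (auto simp: ext_affine_def)
  qed
  have "isCont (ext_affine a b) x" for x
    unfolding isCont_def ext_affine_def using a
    by (intro tendsto_add_ereal_general tendsto_cmult_ereal tendsto_const tendsto_ident_at) auto
  then show "continuous_on UNIV (ext_affine a b)"
    by (simp add: continuous_at_imp_continuous_on)
qed (use a in \<open>auto simp: ext_affine_def\<close>)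

text \<open>A negative slope is a reflection followed by the affine map of slope \<open>- a\<close>,
  and the reflection supplies the sign.\<close>

lemma has_HS_integral_compose_affine:
  assumes int: "has_HS_integral g F A" and a: "a \<noteq> 0"
  shows "has_HS_integral (\<lambda>t. g (ext_affine a b t)) (\<lambda>t. F (ext_affine a b t)) (sgn a * A)"
proof (cases "a > 0")
  case True
  then show ?thesis
    using has_HS_integral_compose_affine_pos[OF int] by simp
next
  case False
  with a have "- a > 0" by simp
  have "ext_affine (- a) b (- t) = ext_affine a b t" for t
    using a by (cases t) (auto simp: ext_affine_def)
  then show ?thesis
    using has_HS_integral_reflect[OF has_HS_integral_compose_affine_pos[OF int \<open>- a > 0\<close>, of b]]
      False a by simp
qed

section \<open>The density of an iterated integral\<close>

text \<open>Covers one-sided limits and limits at \<open>\<plusminus>\<infinity>\<close> at once: what holds eventually holds on an open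
  set, so it passes to the one-sided limits taken at nearby points.\<close>

definition open_based :: "real filter \<Rightarrow> bool" where
  "open_based \<F> \<longleftrightarrow> \<F> \<noteq> bot \<and> (\<forall>P. eventually P \<F> \<longrightarrow> (\<forall>\<^sub>F y in \<F>. eventually P (nhds y)))"

lemma open_based_at_within:
  assumes "open S" "at x within S \<noteq> bot"
  shows "open_based (at x within S)"
  unfolding open_based_def
proof (intro conjI allI impI)
  fix P assume "eventually P (at x within S)"
  then obtain T where T: "open T" "x \<in> T" "\<And>y. y \<in> T \<Longrightarrow> y \<noteq> x \<Longrightarrow> y \<in> S \<Longrightarrow> P y"
    unfolding eventually_at_topological by blast
  have "eventually P (nhds y)" if "y \<in> T" "y \<noteq> x" "y \<in> S" for y
    unfolding eventually_nhds using T assms(1) that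
    by (intro exI[of _ "T \<inter> S - {x}"]) (auto intro!: open_Diff open_Int)
  then show "\<forall>\<^sub>F y in at x within S. eventually P (nhds y)"
    unfolding eventually_at_topological using T by blast
qed (rule assms(2))

lemma open_based_at_left: "open_based (at_left x)"
  and open_based_at_right: "open_based (at_right x)"
  by (rule open_based_at_within; simp)+

lemma open_based_at_top: "open_based at_top"
  unfolding open_based_def
proof (intro conjI allI impI)
  fix P :: "real \<Rightarrow> bool" assume "eventually P at_top"
  then obtain K where K: "\<And>y. K \<le> y \<Longrightarrow> P y"
    unfolding eventually_at_top_linorder by blast
  have "eventually P (nhds y)" if "K < y" for y
    unfolding eventually_nhds using K that by (intro exI[of _ "{K<..}"]) auto
  then show "\<forall>\<^sub>F y in at_top. eventually P (nhds y)"
    unfolding eventually_at_top_dense by blast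
qed simp

lemma open_based_at_bot: "open_based at_bot"
  unfolding open_based_def
proof (intro conjI allI impI)
  fix P :: "real \<Rightarrow> bool" assume "eventually P at_bot"
  then obtain K where K: "\<And>y. y \<le> K \<Longrightarrow> P y"
    unfolding eventually_at_bot_linorder by blast
  have "eventually P (nhds y)" if "y < K" for y
    unfolding eventually_nhds using K that by (intro exI[of _ "{..<K}"]) auto
  then show "\<forall>\<^sub>F y in at_bot. eventually P (nhds y)"
    unfolding eventually_at_bot_dense by blast
qed simp

text \<open>The candidate for the density in \<open>NBV lam\<close>. Infinite points keep their
  values, as required by the convention that these are limits; \<open>Lim\<close> is meaningful
  wherever the one-sided limits exist.\<close>

definition normalise :: "real \<Rightarrow> (ereal \<Rightarrow> real) \<Rightarrow> ereal \<Rightarrow> real" where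
  "normalise lam g t = (if \<bar>t\<bar> = \<infinity> then g t else
     (1 - lam) * Lim (at_left (real_of_ereal t)) (\<lambda>y. g (ereal y)) +
     lam * Lim (at_right (real_of_ereal t)) (\<lambda>y. g (ereal y)))"

lemma normalise_infinity [simp]: "normalise lam g \<infinity> = g \<infinity>" "normalise lam g (-\<infinity>) = g (-\<infinity>)"
  by (simp_all add: normalise_def)

lemma normalise_real:
  assumes "((\<lambda>y. g (ereal y)) \<longlongrightarrow> l) (at_left x)" "((\<lambda>y. g (ereal y)) \<longlongrightarrow> r) (at_right x)"
  shows "normalise lam g (ereal x) = (1 - lam) * l + lam * r"
  using tendsto_Lim[OF _ assms(1)] tendsto_Lim[OF _ assms(2)] by (simp add: normalise_def)

text \<open>The point at which the condition that \<open>lam\<close> lies in [0,1] enters: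
  normalised values obey any bounds common to both one-sided limits.\<close>

lemma convex_combination_between:
  fixes l r :: real
  assumes "0 \<le> lam" "lam \<le> 1" "m \<le> l" "m \<le> r" "l \<le> M" "r \<le> M"
  shows "m \<le> (1 - lam) * l + lam * r" "(1 - lam) * l + lam * r \<le> M"
proof -
  have "(1 - lam) * m + lam * m \<le> (1 - lam) * l + lam * r"
    "(1 - lam) * l + lam * r \<le> (1 - lam) * M + lam * M"
    using assms by (intro add_mono mult_left_mono; simp)+
  then show "m \<le> (1 - lam) * l + lam * r" "(1 - lam) * l + lam * r \<le> M"
    by (simp_all add: algebra_simps)
qed

text \<open>Closeness of \<open>g\<close> to \<open>c\<close> holds on a whole neighbourhood of
  nearby points \<open>x\<close>, hence bounds both one-sided limits at \<open>x\<close> and their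
  convex combination. Starting from \<open>e / 2\<close> makes up for the strict inequality lost in
  passing to limits.\<close>

lemma tendsto_normalise:
  assumes \<F>: "open_based \<F>" and lim: "((\<lambda>y. g (ereal y)) \<longlongrightarrow> c) \<F>"
    and left: "\<And>x. \<exists>l. ((\<lambda>y. g (ereal y)) \<longlongrightarrow> l) (at_left x)"
    and right: "\<And>x. \<exists>r. ((\<lambda>y. g (ereal y)) \<longlongrightarrow> r) (at_right x)"
    and lam: "0 \<le> lam" "lam \<le> 1"
  shows "((\<lambda>y. normalise lam g (ereal y)) \<longlongrightarrow> c) \<F>"
proof (rule tendstoI)
  fix e :: real assume "e > 0"
  then have "e / 2 > 0" by simp
  from tendstoD[OF lim this] \<F>
  have "\<forall>\<^sub>F x in \<F>. \<forall>\<^sub>F y in nhds x. dist (g (ereal y)) c < e / 2"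
    unfolding open_based_def by blast
  then show "\<forall>\<^sub>F x in \<F>. dist (normalise lam g (ereal x)) c < e"
  proof eventually_elim
    fix x assume ev: "\<forall>\<^sub>F y in nhds x. dist (g (ereal y)) c < e / 2"
    obtain l r where l: "((\<lambda>y. g (ereal y)) \<longlongrightarrow> l) (at_left x)"
      and r: "((\<lambda>y. g (ereal y)) \<longlongrightarrow> r) (at_right x)"
      using left right by blast
    have near: "c - e / 2 \<le> g (ereal y) \<and> g (ereal y) \<le> c + e / 2"
      if "dist (g (ereal y)) c < e / 2" for y
      using that unfolding dist_real_def by linarith
    have evl: "\<forall>\<^sub>F y in at_left x. c - e / 2 \<le> g (ereal y) \<and> g (ereal y) \<le> c + e / 2"
      unfolding eventually_at_filter using ev by eventually_elim (use near in blast)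
    have evr: "\<forall>\<^sub>F y in at_right x. c - e / 2 \<le> g (ereal y) \<and> g (ereal y) \<le> c + e / 2"
      unfolding eventually_at_filter using ev by eventually_elim (use near in blast)
    have "c - e / 2 \<le> l" "l \<le> c + e / 2" "c - e / 2 \<le> r" "r \<le> c + e / 2"
      using tendsto_lowerbound[OF l] tendsto_upperbound[OF l]
        tendsto_lowerbound[OF r] tendsto_upperbound[OF r]
        evl[THEN eventually_mono] evr[THEN eventually_mono]
      by simp_all
    from convex_combination_between[OF lam this(1,3,2,4)] \<open>e > 0\<close>
    show "dist (normalise lam g (ereal x)) c < e"
      unfolding normalise_real[OF l r] dist_real_def by linarith
  qed
qed

text \<open>The limit is the supremum of the values to the left. Its position relative to all values
  of \<open>P\<close> is recorded for the proof that normalisation preserves monotonicity.\<close>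

lemma mono_left_limit:
  fixes P :: "ereal \<Rightarrow> real"
  assumes "mono P"
  obtains l where "((\<lambda>y. P (ereal y)) \<longlongrightarrow> l) (at_left x)"
    "\<And>w. w < ereal x \<Longrightarrow> P w \<le> l" "\<And>w. ereal x \<le> w \<Longrightarrow> l \<le> P w"
proof -
  define l where "l = (SUP y\<in>{..<x}. P (ereal y))"
  have lim: "((\<lambda>y. P (ereal y)) \<longlongrightarrow> l) (at_left x)"
    unfolding l_def
    by (rule Lim_left_bound[where I = UNIV and K = "P (ereal x)", simplified])
      (auto intro!: monoD[OF assms])
  show ?thesis
  proof (rule that[OF lim])
    fix w assume w: "w < ereal x"
    then obtain b where b: "w < ereal b" "b < x"
      using ereal_dense2[OF w] by auto
    have "P w \<le> P (ereal y)" if "b < y" for y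
      using order.strict_trans[OF b(1), of "ereal y"] that by (intro monoD[OF assms]) simp
    then have "\<forall>\<^sub>F y in at_left x. P w \<le> P (ereal y)"
      unfolding eventually_at_left[OF b(2)] using b(2) by blast
    then show "P w \<le> l"
      by (rule tendsto_lowerbound[OF lim]) simp
  next
    fix w assume w: "ereal x \<le> w"
    have "P (ereal y) \<le> P w" if "y < x" for y
      using order.trans[OF _ w, of "ereal y"] that by (intro monoD[OF assms]) simp
    then have "\<forall>\<^sub>F y in at_left x. P (ereal y) \<le> P w"
      unfolding eventually_at_filter by (intro always_eventually) simp
    then show "l \<le> P w"
      by (rule tendsto_upperbound[OF lim]) simp
  qed
qed

text \<open>Reduced to left limits by \<open>\<lambda>t. - P (- t)\<close>, which is again
  monotone.\<close>

lemma mono_right_limit: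
  fixes P :: "ereal \<Rightarrow> real"
  assumes "mono P"
  obtains r where "((\<lambda>y. P (ereal y)) \<longlongrightarrow> r) (at_right x)"
    "\<And>w. ereal x < w \<Longrightarrow> r \<le> P w" "\<And>w. w \<le> ereal x \<Longrightarrow> P w \<le> r"
proof -
  have "mono (\<lambda>t. - P (- t))"
    using assms by (auto simp: mono_def)
  from mono_left_limit[OF this, of "- x"] obtain l where
    l: "((\<lambda>y. - P (- ereal y)) \<longlongrightarrow> l) (at_left (- x))"
    "\<And>w. w < ereal (- x) \<Longrightarrow> - P (- w) \<le> l" "\<And>w. ereal (- x) \<le> w \<Longrightarrow> l \<le> - P (- w)"
    by blast
  show ?thesis
  proof (rule that[of "- l"])
    show "((\<lambda>y. P (ereal y)) \<longlongrightarrow> - l) (at_right x)"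
      using tendsto_minus[OF l(1)] by (simp add: at_left_minus filterlim_filtermap)
    show "- l \<le> P w" if "ereal x < w" for w
      using l(2)[of "- w"] that by (cases w) auto
    show "P w \<le> - l" if "w \<le> ereal x" for w
      using l(3)[of "- w"] that by (cases w) auto
  qed
qed

text \<open>For \<open>s < t\<close> any \<open>w\<close> strictly between them separates the
  normalised values: the one at \<open>s\<close> is at most \<open>P w\<close>, the one at
  \<open>t\<close> at least \<open>P w\<close>.\<close>

lemma mono_normalise:
  fixes P :: "ereal \<Rightarrow> real"
  assumes P: "mono P" and lam: "0 \<le> lam" "lam \<le> 1"
  shows "mono (normalise lam P)"
proof -
  have bd: "P u \<le> normalise lam P (ereal x)" "normalise lam P (ereal x) \<le> P v"
    if uv: "u < ereal x" "ereal x < v" for u v x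
  proof -
    obtain l where l: "((\<lambda>y. P (ereal y)) \<longlongrightarrow> l) (at_left x)"
      "\<And>w. w < ereal x \<Longrightarrow> P w \<le> l" "\<And>w. ereal x \<le> w \<Longrightarrow> l \<le> P w"
      using mono_left_limit[OF P, of x] by blast
    obtain r where r: "((\<lambda>y. P (ereal y)) \<longlongrightarrow> r) (at_right x)"
      "\<And>w. ereal x < w \<Longrightarrow> r \<le> P w" "\<And>w. w \<le> ereal x \<Longrightarrow> P w \<le> r"
      using mono_right_limit[OF P, of x] by blast
    from convex_combination_between[OF lam l(2)[OF uv(1)] r(3)[OF less_imp_le[OF uv(1)]]
        l(3)[OF less_imp_le[OF uv(2)]] r(2)[OF uv(2)]]
    show "P u \<le> normalise lam P (ereal x)" "normalise lam P (ereal x) \<le> P v"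
      unfolding normalise_real[OF l(1) r(1)] .
  qed
  \<comment> \<open>At a finite \<open>s\<close>, \<open>bd\<close> asks for a point on each side,
    and -\<infinity> serves as the left one. At an infinite \<open>s\<close> the normalised value is
    \<open>P s\<close>.\<close>
  have above: "normalise lam P s \<le> P w" if "s < w" for s w
    using bd(2)[of "-\<infinity>" _ w] that monoD[OF P, of s w] by (cases s) auto
  have below: "P w \<le> normalise lam P s" if "w < s" for s w
    using bd(1)[of w _ \<infinity>] that monoD[OF P, of w s] by (cases s) auto
  show ?thesis
  proof (rule monoI)
    fix s t :: ereal assume "s \<le> t"
    show "normalise lam P s \<le> normalise lam P t"
    proof (cases "s = t")
      case False
      with \<open>s \<le> t\<close> have "s < t" by simp
      from dense[OF this] obtain w where "s < w" "w < t" by blast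
      with above[of s w] below[of w t] show ?thesis by linarith
    qed simp
  qed
qed

lemma mono_ex_left_limit:
  fixes P :: "ereal \<Rightarrow> real"
  assumes "mono P"
  shows "\<exists>l. ((\<lambda>y. P (ereal y)) \<longlongrightarrow> l) (at_left x)"
  by (rule mono_left_limit[OF assms, of x]) (rule exI)

lemma mono_ex_right_limit:
  fixes P :: "ereal \<Rightarrow> real"
  assumes "mono P"
  shows "\<exists>r. ((\<lambda>y. P (ereal y)) \<longlongrightarrow> r) (at_right x)"
  by (rule mono_right_limit[OF assms, of x]) (rule exI)

lemma normalise_diff:
  assumes P: "mono P" and Q: "mono Q"
  shows "normalise lam (\<lambda>t. P t - Q t) = (\<lambda>t. normalise lam P t - normalise lam Q t)"
proof
  fix t
  show "normalise lam (\<lambda>t. P t - Q t) t = normalise lam P t - normalise lam Q t"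
  proof (cases t)
    case (real x)
    obtain pl where pl: "((\<lambda>y. P (ereal y)) \<longlongrightarrow> pl) (at_left x)"
      using mono_ex_left_limit[OF P, of x] by blast
    obtain pr where pr: "((\<lambda>y. P (ereal y)) \<longlongrightarrow> pr) (at_right x)"
      using mono_ex_right_limit[OF P, of x] by blast
    obtain ql where ql: "((\<lambda>y. Q (ereal y)) \<longlongrightarrow> ql) (at_left x)"
      using mono_ex_left_limit[OF Q, of x] by blast
    obtain qr where qr: "((\<lambda>y. Q (ereal y)) \<longlongrightarrow> qr) (at_right x)"
      using mono_ex_right_limit[OF Q, of x] by blast
    show ?thesis
      unfolding real normalise_real[OF pl pr] normalise_real[OF ql qr]
        normalise_real[OF tendsto_diff[OF pl ql] tendsto_diff[OF pr qr]]
      by (simp add: algebra_simps)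
  qed auto
qed

lemma BV_limits:
  assumes "g \<in> BV"
  shows "\<exists>l. ((\<lambda>y. g (ereal y)) \<longlongrightarrow> l) (at_left x)"
    and "\<exists>r. ((\<lambda>y. g (ereal y)) \<longlongrightarrow> r) (at_right x)"
proof -
  from assms obtain P Q where P: "mono P" and Q: "mono Q" and g: "g = (\<lambda>t. P t - Q t)"
    unfolding BV_iff_mono_diff by blast
  obtain l where "((\<lambda>y. P (ereal y)) \<longlongrightarrow> l) (at_left x)"
    using mono_ex_left_limit[OF P, of x] by blast
  moreover obtain l' where "((\<lambda>y. Q (ereal y)) \<longlongrightarrow> l') (at_left x)"
    using mono_ex_left_limit[OF Q, of x] by blast
  ultimately show "\<exists>l. ((\<lambda>y. g (ereal y)) \<longlongrightarrow> l) (at_left x)"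
    unfolding g by (intro exI) (rule tendsto_diff)
  obtain r where "((\<lambda>y. P (ereal y)) \<longlongrightarrow> r) (at_right x)"
    using mono_ex_right_limit[OF P, of x] by blast
  moreover obtain r' where "((\<lambda>y. Q (ereal y)) \<longlongrightarrow> r') (at_right x)"
    using mono_ex_right_limit[OF Q, of x] by blast
  ultimately show "\<exists>r. ((\<lambda>y. g (ereal y)) \<longlongrightarrow> r) (at_right x)"
    unfolding g by (intro exI) (rule tendsto_diff)
qed

text \<open>Normalisation preserves all one-sided limits, so the average defining the new value is
  also the average of the new function's own limits.\<close>

lemma normalise_in_NBV:
  assumes g: "g \<in> BV" and lam: "0 \<le> lam" "lam \<le> 1"
  shows "normalise lam g \<in> NBV lam"
proof -
  note lims = BV_limits[OF g]
  have lim: "((\<lambda>y. normalise lam g (ereal y)) \<longlongrightarrow> c) \<F>"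
    if "open_based \<F>" "((\<lambda>y. g (ereal y)) \<longlongrightarrow> c) \<F>" for c \<F>
    by (rule tendsto_normalise[OF that lims lam])
  from g obtain P Q where P: "mono P" and Q: "mono Q" and eq: "g = (\<lambda>t. P t - Q t)"
    unfolding BV_iff_mono_diff by blast
  have "limits_at_infinity (normalise lam g)"
    using g lim open_based_at_top open_based_at_bot
    unfolding BV_iff_mono_diff limits_at_infinity_def by simp
  moreover have "normalise lam g = (\<lambda>t. normalise lam P t - normalise lam Q t)"
    unfolding eq by (rule normalise_diff[OF P Q])
  ultimately have "normalise lam g \<in> BV"
    unfolding BV_iff_mono_diff using mono_normalise[OF P lam] mono_normalise[OF Q lam] by blast
  moreover have "\<exists>l r. ((\<lambda>y. normalise lam g (ereal y)) \<longlongrightarrow> l) (at_left x) \<and>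
       ((\<lambda>y. normalise lam g (ereal y)) \<longlongrightarrow> r) (at_right x) \<and>
       normalise lam g (ereal x) = (1 - lam) * l + lam * r" for x
  proof -
    obtain l r where l: "((\<lambda>y. g (ereal y)) \<longlongrightarrow> l) (at_left x)"
      and r: "((\<lambda>y. g (ereal y)) \<longlongrightarrow> r) (at_right x)"
      using lims by blast
    from lim[OF open_based_at_left l] lim[OF open_based_at_right r] normalise_real[OF l r]
    show ?thesis by blast
  qed
  ultimately show ?thesis
    unfolding NBV_def by blast
qed

lemma mono_compose_ereal:
  fixes P :: "ereal \<Rightarrow> real"
  assumes "mono P"
  shows "mono (\<lambda>x. P (ereal x))"
  using assms by (auto simp: mono_def)

lemma BV_measurable:
  assumes "g \<in> BV"
  shows "(\<lambda>x. g (ereal x)) \<in> borel_measurable borel"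
proof -
  from assms obtain P Q where P: "mono P" and Q: "mono Q" and g: "g = (\<lambda>t. P t - Q t)"
    unfolding BV_iff_mono_diff by blast
  show ?thesis
    unfolding g
    by (intro borel_measurable_diff borel_measurable_mono mono_compose_ereal P Q)
qed

text \<open>Monotone functions have countably many discontinuities. Elsewhere both one-sided limits
  equal the value of \<open>g\<close>, and the weights add up to 1.\<close>

lemma AE_normalise_eq:
  assumes "g \<in> BV"
  shows "AE x in lborel. g (ereal x) = normalise lam g (ereal x)"
proof -
  from assms obtain P Q where P: "mono P" and Q: "mono Q" and g: "g = (\<lambda>t. P t - Q t)"
    unfolding BV_iff_mono_diff by blast
  define D where "D = {x. \<not> isCont (\<lambda>x. P (ereal x)) x} \<union> {x. \<not> isCont (\<lambda>x. Q (ereal x)) x}"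
  have "countable D"
    unfolding D_def using P Q by (intro countable_Un mono_ctble_discont mono_compose_ereal)
  then have "D \<in> null_sets lborel"
    by (rule countable_imp_null_set_lborel)
  then show ?thesis
  proof (rule AE_I')
    show "{x \<in> space lborel. g (ereal x) \<noteq> normalise lam g (ereal x)} \<subseteq> D"
    proof
      fix x assume x: "x \<in> {x \<in> space lborel. g (ereal x) \<noteq> normalise lam g (ereal x)}"
      show "x \<in> D"
      proof (rule ccontr)
        assume "x \<notin> D"
        then have "isCont (\<lambda>x. g (ereal x)) x"
          unfolding D_def g by (auto intro!: continuous_intros)
        then have "((\<lambda>x. g (ereal x)) \<longlongrightarrow> g (ereal x)) (at_left x)"
          "((\<lambda>x. g (ereal x)) \<longlongrightarrow> g (ereal x)) (at_right x)"
          unfolding isCont_def by (auto simp: filterlim_at_split)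
        from normalise_real[OF this, of lam] x show False
          by (simp add: algebra_simps)
      qed
    qed
  qed
qed

section \<open>Iterated integrals: invariance under normalisation and recovery of the
  density\<close>

lemma iter_integral_Suc_cong:
  assumes "iter_integral 1 q = iter_integral 1 r"
  shows "iter_integral (Suc m) q = iter_integral (Suc m) r"
proof (induction m)
  case 0
  then show ?case using assms by simp
next
  case (Suc m)
  show ?case
    unfolding iter_integral.simps(2)[of "Suc m"] Suc ..
qed

text \<open>A change on a null set disappears after one integration, and all higher orders depend
  only on the first. At order 0 it remains visible, hence the separate case in
  \<open>stieltjes_density\<close>.\<close>

lemma iter_integral_normalise:
  assumes g: "g \<in> BV" and lam: "0 \<le> lam" "lam \<le> 1"
  shows "iter_integral (Suc m) (\<lambda>x. g (ereal x)) = iter_integral (Suc m) (\<lambda>x. normalise lam g (ereal x))"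
proof (rule iter_integral_Suc_cong)
  have "normalise lam g \<in> BV"
    using normalise_in_NBV[OF assms] unfolding NBV_def by blast
  then show "iter_integral 1 (\<lambda>x. g (ereal x)) = iter_integral 1 (\<lambda>x. normalise lam g (ereal x))"
    using AE_normalise_eq[OF g, of lam]
    by (auto intro!: interval_integral_cong_AE BV_measurable g simp: fun_eq_iff elim: eventually_mono)
qed

text \<open>One class containing the possibly discontinuous functions of bounded variation and their
  continuous iterated integrals. It is closed under differences and ensures integrability on bounded
  intervals.\<close>

definition loc_bounded_borel :: "(real \<Rightarrow> real) \<Rightarrow> bool" where
  "loc_bounded_borel f \<longleftrightarrow> f \<in> borel_measurable borel \<and> (\<forall>a b. \<exists>M. \<forall>t\<in>{a..b}. \<bar>f t\<bar> \<le> M)"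

lemma loc_bounded_borel_BV:
  assumes "g \<in> BV"
  shows "loc_bounded_borel (\<lambda>x. g (ereal x))"
proof -
  from assms obtain P Q where P: "mono P" and Q: "mono Q" and g: "g = (\<lambda>t. P t - Q t)"
    unfolding BV_iff_mono_diff by blast
  have "\<bar>g t\<bar> \<le> (\<bar>P \<infinity>\<bar> + \<bar>P (-\<infinity>)\<bar>) + (\<bar>Q \<infinity>\<bar> + \<bar>Q (-\<infinity>)\<bar>)" for t
    using mono_ereal_bounded[OF P, of t] mono_ereal_bounded[OF Q, of t] unfolding g by linarith
  then show ?thesis
    unfolding loc_bounded_borel_def using BV_measurable[OF assms] by blast
qed

lemma loc_bounded_borel_continuous:
  assumes "continuous_on UNIV f"
  shows "loc_bounded_borel f"
  unfolding loc_bounded_borel_def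
proof (intro conjI allI)
  show "f \<in> borel_measurable borel"
    by (rule borel_measurable_continuous_onI[OF assms])
  fix a b :: real
  have "compact (f ` {a..b})"
    by (intro compact_continuous_image continuous_on_subset[OF assms]) auto
  then have "bounded (f ` {a..b})"
    by (rule compact_imp_bounded)
  then show "\<exists>M. \<forall>t\<in>{a..b}. \<bar>f t\<bar> \<le> M"
    unfolding bounded_iff by auto
qed

lemma loc_bounded_borel_diff:
  assumes "loc_bounded_borel f" "loc_bounded_borel g"
  shows "loc_bounded_borel (\<lambda>x. f x - g x)"
  unfolding loc_bounded_borel_def
proof (intro conjI allI)
  show "(\<lambda>x. f x - g x) \<in> borel_measurable borel"
    using assms unfolding loc_bounded_borel_def by (intro borel_measurable_diff) auto
  fix a b :: real
  obtain M N where "\<forall>t\<in>{a..b}. \<bar>f t\<bar> \<le> M" "\<forall>t\<in>{a..b}. \<bar>g t\<bar> \<le> N"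
    using assms unfolding loc_bounded_borel_def by blast
  then have "\<forall>t\<in>{a..b}. \<bar>f t - g t\<bar> \<le> M + N"
    by fastforce
  then show "\<exists>M. \<forall>t\<in>{a..b}. \<bar>f t - g t\<bar> \<le> M" ..
qed

lemma loc_bounded_borel_set_integrable:
  assumes "loc_bounded_borel f"
  shows "set_integrable lborel {a..b} f"
proof -
  obtain M where "\<forall>t\<in>{a..b}. \<bar>f t\<bar> \<le> M" and "f \<in> borel_measurable borel"
    using assms unfolding loc_bounded_borel_def by blast
  then show ?thesis
    unfolding set_integrable_def
    by (intro integrableI_bounded_set_indicator[where B = M])
      (auto simp: emeasure_lborel_Icc_eq)
qed

lemma loc_bounded_borel_interval_integrable:
  assumes "loc_bounded_borel f"
  shows "interval_lebesgue_integrable lborel (ereal a) (ereal b) f"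
proof -
  have "set_integrable lborel {u<..<v} f" for u v
    by (rule set_integrable_subset[OF loc_bounded_borel_set_integrable[OF assms, of u v]]) auto
  then show ?thesis
    unfolding interval_lebesgue_integrable_def by simp
qed

lemma loc_bounded_borel_integral_combine:
  assumes "loc_bounded_borel f"
  shows "(LBINT t=ereal a..ereal b. f t) + (LBINT t=ereal b..ereal c. f t) = (LBINT t=ereal a..ereal c. f t)"
proof (rule interval_integral_sum)
  show "interval_lebesgue_integrable lborel (min (ereal a) (min (ereal b) (ereal c)))
      (max (ereal a) (max (ereal b) (ereal c))) f"
    using loc_bounded_borel_interval_integrable[OF assms, of "min a (min b c)" "max a (max b c)"]
    by (simp add: min_def max_def split: if_splits)
qed

lemma continuous_on_interval_integral:
  assumes f: "loc_bounded_borel f"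
  shows "continuous_on UNIV (\<lambda>x. LBINT t=ereal a..ereal x. f t)"
proof (rule continuous_at_imp_continuous_on, rule ballI)
  fix x :: real
  \<comment> \<open>The base point \<open>a\<close> may lie on either side of \<open>x\<close>.
    Moving it to \<open>K\<close> on the left costs only an additive constant and makes the
    continuity of indefinite integrals on a compact interval around \<open>x\<close>
    applicable.\<close>
  define K where "K = x - 1"
  have "f integrable_on {K..x + 1}"
    using loc_bounded_borel_set_integrable[OF f] by (rule set_borel_integral_eq_integral(1))
  then have "continuous_on {K..x + 1} (\<lambda>y. integral {K..y} f + (LBINT t=ereal a..ereal K. f t))"
    by (intro continuous_intros indefinite_integral_continuous_1)
  moreover have "integral {K..y} f + (LBINT t=ereal a..ereal K. f t) = (LBINT t=ereal a..ereal y. f t)"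
    if "y \<in> {K..x + 1}" for y
    using loc_bounded_borel_integral_combine[OF f, of a K y]
      interval_integral_eq_integral[OF _ loc_bounded_borel_set_integrable[OF f], of K y] that by simp
  ultimately have "continuous_on {K..x + 1} (\<lambda>y. LBINT t=ereal a..ereal y. f t)"
    by (rule iffD1[OF continuous_on_cong[OF refl], rotated])
  then show "isCont (\<lambda>y. LBINT t=ereal a..ereal y. f t) x"
    by (rule continuous_on_interior) (simp add: K_def)
qed

text \<open>A positive limit \<open>c\<close> would make \<open>d\<close> exceed
  \<open>c / 2\<close> on a neighbourhood of some point, by \<open>open_based\<close>, so its
  integral over a short interval there would be positive. For limits of two functions, exchanging
  them gives the reverse inequality.\<close>

lemma zero_integrals_imp_lim_nonpos:
  assumes d: "loc_bounded_borel d" and zero: "\<And>y. (LBINT t=ereal 0..ereal y. d t) = 0"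
    and \<F>: "open_based \<F>" and lim: "(d \<longlongrightarrow> c) \<F>"
  shows "c \<le> 0"
proof (rule ccontr)
  assume "\<not> c \<le> 0"
  then have "c / 2 < c" "c > 0" by auto
  from order_tendstoD(1)[OF lim this(1)] \<F>
  have "\<forall>\<^sub>F x in \<F>. \<forall>\<^sub>F y in nhds x. c / 2 < d y" and "\<F> \<noteq> bot"
    unfolding open_based_def by blast+
  then obtain x where "\<forall>\<^sub>F y in nhds x. c / 2 < d y"
    using eventually_happens' by blast
  then obtain e where e: "e > 0" "\<And>y. dist y x < e \<Longrightarrow> c / 2 < d y"
    unfolding eventually_nhds_metric by blast
  define v where "v = x + e / 2"
  have v: "x < v" "\<And>y. y \<in> {x..v} \<Longrightarrow> c / 2 \<le> d y"
    using e(1) e(2)[THEN less_imp_le] by (auto simp: v_def dist_real_def)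
  have "c / 2 * (v - x) = (LBINT t:{x..v}. c / 2)"
    using v(1) by (simp add: set_lebesgue_integral_def)
  also have "\<dots> \<le> (LBINT t:{x..v}. d t)"
    using v(2) loc_bounded_borel_set_integrable[OF d]
      loc_bounded_borel_set_integrable[OF loc_bounded_borel_continuous[OF continuous_on_const]]
    by (intro set_integral_mono) auto
  also have "\<dots> = (LBINT t=ereal x..ereal v. d t)"
    using v(1) by (simp add: interval_integral_Icc)
  also have "\<dots> = 0"
    using loc_bounded_borel_integral_combine[OF d, of 0 x v] unfolding zero by simp
  finally show False
    using v(1) \<open>c > 0\<close> by (simp add: mult_le_0_iff)
qed

lemma equal_integrals_imp_lim_le:
  assumes f: "loc_bounded_borel f" and g: "loc_bounded_borel g"
    and eq: "iter_integral 1 f = iter_integral 1 g"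
    and \<F>: "open_based \<F>" and lim: "(f \<longlongrightarrow> l) \<F>" "(g \<longlongrightarrow> l') \<F>"
  shows "l \<le> l'"
proof -
  have "(LBINT t=ereal 0..ereal y. f t - g t) = 0" for y
    using fun_cong[OF eq, of y]
      interval_lebesgue_integral_diff(2)[OF loc_bounded_borel_interval_integrable[OF f]
        loc_bounded_borel_interval_integrable[OF g], of 0 y] by simp
  from zero_integrals_imp_lim_nonpos[OF loc_bounded_borel_diff[OF f g] this \<F> tendsto_diff[OF lim]]
  show ?thesis by simp
qed

lemma equal_integrals_imp_lim_eq:
  assumes "loc_bounded_borel f" "loc_bounded_borel g" "iter_integral 1 f = iter_integral 1 g"
    "open_based \<F>" "(f \<longlongrightarrow> l) \<F>" "(g \<longlongrightarrow> l') \<F>"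
  shows "l = l'"
  using equal_integrals_imp_lim_le[OF assms]
    equal_integrals_imp_lim_le[OF assms(2,1) assms(3)[symmetric] assms(4,6,5)] by simp

lemma iter_integral_Suc_continuous:
  assumes "loc_bounded_borel f"
  shows "continuous_on UNIV (iter_integral (Suc m) f)"
proof (induction m)
  case 0
  then show ?case using continuous_on_interval_integral[OF assms, of 0] by simp
next
  case (Suc m)
  from continuous_on_interval_integral[OF loc_bounded_borel_continuous[OF this], of 0]
  show ?case by simp
qed

text \<open>Integrations are peeled off one at a time: a continuous function equals its right
  limits, which its integral determines. The descent stops at order 1, because the density itself is
  determined only through its one-sided limits.\<close>

lemma iter_integral_Suc_inject:
  assumes f: "loc_bounded_borel f" and g: "loc_bounded_borel g"
    and "iter_integral (Suc m) f = iter_integral (Suc m) g"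
  shows "iter_integral 1 f = iter_integral 1 g"
  using assms(3)
proof (induction m)
  case (Suc m)
  note cf = iter_integral_Suc_continuous[OF f, of m]
    and cg = iter_integral_Suc_continuous[OF g, of m]
  have 1: "iter_integral 1 (iter_integral (Suc m) f) = iter_integral 1 (iter_integral (Suc m) g)"
    using Suc.prems by simp
  have eq: "iter_integral (Suc m) f x = iter_integral (Suc m) g x" for x
  proof (rule equal_integrals_imp_lim_eq[OF loc_bounded_borel_continuous[OF cf]
        loc_bounded_borel_continuous[OF cg] 1 open_based_at_right])
    show "(iter_integral (Suc m) f \<longlongrightarrow> iter_integral (Suc m) f x) (at_right x)"
      "(iter_integral (Suc m) g \<longlongrightarrow> iter_integral (Suc m) g x) (at_right x)"
      using cf cg by (auto simp: continuous_on_def intro: tendsto_within_subset)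
  qed
  then show ?case
    by (intro Suc.IH ext eq)
qed simp

lemma BV_eqI:
  assumes "g \<in> BV" "g' \<in> BV" "\<And>x. g (ereal x) = g' (ereal x)"
  shows "g = g'"
proof
  have "limits_at_infinity g" "limits_at_infinity g'"
    using assms(1,2) by (simp_all add: BV_iff_mono_diff)
  then have lims: "((\<lambda>x. g' (ereal x)) \<longlongrightarrow> g \<infinity>) at_top" "((\<lambda>x. g' (ereal x)) \<longlongrightarrow> g (-\<infinity>)) at_bot"
    "((\<lambda>x. g' (ereal x)) \<longlongrightarrow> g' \<infinity>) at_top" "((\<lambda>x. g' (ereal x)) \<longlongrightarrow> g' (-\<infinity>)) at_bot"
    unfolding limits_at_infinity_def assms(3) by simp_all
  have "g \<infinity> = g' \<infinity>" "g (-\<infinity>) = g' (-\<infinity>)"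
    using tendsto_unique[OF _ lims(1,3)] tendsto_unique[OF _ lims(2,4)] by simp_all
  then show "g t = g' t" for t
    using assms(3) by (cases t) auto
qed

text \<open>The first antiderivative determines both one-sided limits at every \<open>x\<close>, and
  the normalisation computes the value from them.\<close>

lemma NBV_unique:
  assumes g: "g \<in> NBV lam" and g': "g' \<in> NBV lam"
    and eq: "iter_integral (Suc m) (\<lambda>x. g (ereal x)) = iter_integral (Suc m) (\<lambda>x. g' (ereal x))"
  shows "g = g'"
proof (rule BV_eqI)
  show BV: "g \<in> BV" "g' \<in> BV"
    using g g' unfolding NBV_def by blast+
  note lb = loc_bounded_borel_BV[OF BV(1)] loc_bounded_borel_BV[OF BV(2)]
  note lim_eq = equal_integrals_imp_lim_eq[OF lb iter_integral_Suc_inject[OF lb eq]]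
  fix x
  obtain l r where 1: "((\<lambda>y. g (ereal y)) \<longlongrightarrow> l) (at_left x)"
    "((\<lambda>y. g (ereal y)) \<longlongrightarrow> r) (at_right x)" "g (ereal x) = (1 - lam) * l + lam * r"
    using g unfolding NBV_def by blast
  obtain l' r' where 2: "((\<lambda>y. g' (ereal y)) \<longlongrightarrow> l') (at_left x)"
    "((\<lambda>y. g' (ereal y)) \<longlongrightarrow> r') (at_right x)" "g' (ereal x) = (1 - lam) * l' + lam * r'"
    using g' unfolding NBV_def by blast
  show "g (ereal x) = g' (ereal x)"
    using lim_eq[OF open_based_at_left 1(1) 2(1)] lim_eq[OF open_based_at_right 1(2) 2(2)] 1(3) 2(3)
    by simp
qed

text \<open>A definite description inherits its defining property only from existence and
  uniqueness. For \<open>m = 0\<close> these come from \<open>h\<close> and the limit convention at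
  infinity, for larger \<open>m\<close> from normalisation and \<open>NBV_unique\<close>.\<close>

lemma stieltjes_density_BV:
  assumes h: "h \<in> IBV m" and lam: "0 \<le> lam" "lam \<le> 1"
  shows "stieltjes_density lam m h \<in> BV"
proof -
  define C where "C g \<longleftrightarrow> g \<in> (if m = 0 then BV else NBV lam) \<and> h = iter_integral m (\<lambda>x. g (ereal x))" for g
  obtain g where g: "g \<in> BV" "h = iter_integral m (\<lambda>x. g (ereal x))"
    using h unfolding IBV_def by blast
  have "\<exists>g. C g"
  proof (cases m)
    case 0
    with g show ?thesis unfolding C_def by auto
  next
    case (Suc k)
    then show ?thesis
      unfolding C_def using normalise_in_NBV[OF g(1) lam] iter_integral_normalise[OF g(1) lam, of k] g(2)
      by auto
  qed
  then obtain g0 where g0: "C g0" ..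
  have unique: "g = g'" if "C g" "C g'" for g g'
  proof (cases m)
    case 0
    with that have "g \<in> BV" "g' \<in> BV" "(\<lambda>x. g (ereal x)) = (\<lambda>x. g' (ereal x))"
      unfolding C_def by simp_all
    then show ?thesis
      by (intro BV_eqI) (simp_all add: fun_eq_iff)
  next
    case (Suc k)
    with that have "g \<in> NBV lam" "g' \<in> NBV lam"
      "iter_integral (Suc k) (\<lambda>x. g (ereal x)) = iter_integral (Suc k) (\<lambda>x. g' (ereal x))"
      unfolding C_def by simp_all
    then show ?thesis by (rule NBV_unique)
  qed
  have "C (THE g. C g)"
    by (rule theI[where P = C, OF g0]) (rule unique[OF _ g0])
  then show ?thesis
    unfolding stieltjes_density_def C_def NBV_def by (auto split: if_splits)
qed

theorem theorem15:
  fixes n :: nat and a b lam :: real and F :: "ereal \<Rightarrow> real"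
  assumes "n \<ge> 1" and "a \<noteq> 0" and "0 \<le> lam" and "lam \<le> 1" and "F \<in> B_r"
  shows "dist_eq ((dist_deriv ^^ n) (dist_of (F \<circ> ext_affine a b)))
           (dist_scale (a ^ n) (dist_compose_affine a b ((dist_deriv ^^ n) (dist_of F)))) \<and>
         (\<forall>h \<in> IBV (n - 1).
            dist_integrable lam n F h \<and>
            dist_integrable_compose a b lam n F h \<and>
            dist_integral lam n F h = \<bar>a\<bar> * dist_integral_compose a b lam n F h)"
proof (intro conjI ballI)
  show "dist_eq ((dist_deriv ^^ n) (dist_of (F \<circ> ext_affine a b)))
      (dist_scale (a ^ n) (dist_compose_affine a b ((dist_deriv ^^ n) (dist_of F))))"
    by (rule dist_deriv_compose_affine[OF \<open>a \<noteq> 0\<close>])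
next
  fix h assume "h \<in> IBV (n - 1)"
  define g where "g = stieltjes_density lam (n - 1) h"
  have "g \<in> BV"
    unfolding g_def by (rule stieltjes_density_BV) fact+
  moreover have "regulated F"
    using \<open>F \<in> B_r\<close> unfolding B_r_def by blast
  ultimately have "HS_integrable g F"
    by (rule HS_integrable_BV_regulated)
  then obtain A where A: "has_HS_integral g F A"
    unfolding HS_integrable_def by blast
  \<comment> \<open>The powers of \<open>a\<close> leave \<open>1 / a\<close>, and
    \<open>sgn a / a\<close> is \<open>1 / \<bar>a\<bar>\<close>. Natural subtraction truncates, so
    \<open>n \<ge> 1\<close> is essential here. The sign \<open>(-1) ^ (n - 1)\<close> is common to
    both integrals.\<close>
  have "a ^ (n - 1) * (1 / a ^ n) * (sgn a * A) = A / \<bar>a\<bar>"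
    using \<open>a \<noteq> 0\<close> \<open>n \<ge> 1\<close> by (cases n) (auto simp: sgn_real_def)
  with has_HS_integral_scale[OF has_HS_integral_compose_affine[OF A \<open>a \<noteq> 0\<close>, of b],
      of "a ^ (n - 1)" "1 / a ^ n"]
  have B: "has_HS_integral (density_compose a b lam (n - 1) h) (primitive_compose a b n F) (A / \<bar>a\<bar>)"
    by (simp add: density_compose_def primitive_compose_def g_def)
  show "dist_integrable lam n F h" "dist_integrable_compose a b lam n F h"
    using A B unfolding dist_integrable_def dist_integrable_compose_def HS_integrable_def g_def
    by blast+
  show "dist_integral lam n F h = \<bar>a\<bar> * dist_integral_compose a b lam n F h"
    using \<open>a \<noteq> 0\<close> HS_integral_eq[OF A] HS_integral_eq[OF B]
    by (simp add: dist_integral_def dist_integral_compose_def primitive_integral_def g_def)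
qed

end
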